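(* Let $U_{c_1}(\mathcal S)$ be the Hopf algebra generated by $D,H,P,K,C,M$ with the (undeformed) commutation rules $[D,P]=-P$, $[D,K]=K$, $[K,P]=M$, $[D,H]=-2H$, $[D,C]=2C$, $[H,C]=D$, $[K,H]=P$, $[K,C]=0$, $[P,C]=-K$, $[P,H]=0$, $[M,\cdot]=0$, and coproduct $\Delta(D)=1\otimes D+D\otimes1$, $\Delta(M)=1\otimes M+M\otimes1$, $\Delta(P)=1\otimes P+P\otimes e^{c_1M}$, $\Delta(K)=1\otimes K+K\otimes e^{-c_1M}$, $\Delta(H)=1\otimes H+H\otimes e^{2c_1M}$, $\Delta(C)=1\otimes C+C\otimes e^{-2c_1M}$. Then $$\mathcal R=\exp\{-c_1M\otimes D\}\exp\{c_1D\otimes M\}$$ is a triangular universal $R$-matrix for $U_{c_1}(\mathcal S)$; in particular it satisfies the quantum Yang–Baxter equation $\mathcal R_{12}\mathcal R_{13}\mathcal R_{23}=\mathcal R_{23}\mathcal R_{13}\mathcal R_{12}$ and $\mathcal R\,\Delta(X)\,\mathcal R^{-1}=\sigma\circ\Delta(X)$ for every $X\in U_{c_1}(\mathcal S)$. Its underlying classical $r$-matrix is $r=c_1D\wedge M$.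
   Context: Everything is understood over formal power series $\mathbb R[[c_1]]$ with completed tensor products. $\sigma(X\otimes Y)=Y\otimes X$ and $X\wedge Y=X\otimes Y-Y\otimes X$. A universal $R$-matrix is an invertible $\mathcal R$ with $\mathcal R\Delta(X)\mathcal R^{-1}=\sigma\circ\Delta(X)$, $(\Delta\otimes\mathrm{id})\mathcal R=\mathcal R_{13}\mathcal R_{23}$, $(\mathrm{id}\otimes\Delta)\mathcal R=\mathcal R_{13}\mathcal R_{12}$; it is triangular if moreover $\sigma(\mathcal R)=\mathcal R^{-1}$. The underlying classical $r$-matrix is the first-order term of $\mathcal R$ in the deformation parameter. *)

theory Defs
  imports
    "HOL-Analysis.Analysis"
    "HOL-Analysis.Finite_Function_Topology"
    "HOL-Computational_Algebra.Formal_Power_Series"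
begin

unbundle no vec_syntax
notation fps_nth (infixl \<open>$\<close> 90)

section \<open>Linear extension\<close>

definition lin_ext :: "('k \<Rightarrow> 'v::real_vector) \<Rightarrow> ('k \<Rightarrow>\<^sub>0 real) \<Rightarrow> 'v" where
  "lin_ext f p = (\<Sum>k\<in>Poly_Mapping.keys p. Poly_Mapping.lookup p k *\<^sub>R f k)"

lemma lookup_scaleR [simp]:
  "Poly_Mapping.lookup (r *\<^sub>R p) k = r *\<^sub>R Poly_Mapping.lookup p k"
  unfolding scaleR_poly_mapping_def
proof (subst lookup_Abs_poly_mapping)
  have "{i. r *\<^sub>R Poly_Mapping.lookup p i \<noteq> 0} \<subseteq> Poly_Mapping.keys p"
    by (auto simp: in_keys_iff)
  then show "finite {i. r *\<^sub>R Poly_Mapping.lookup p i \<noteq> 0}"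
    using finite_keys finite_subset by blast
qed simp

lemma lin_ext_superset:
  assumes "finite A" "Poly_Mapping.keys p \<subseteq> A"
  shows "lin_ext f p = (\<Sum>k\<in>A. Poly_Mapping.lookup p k *\<^sub>R f k)"
  unfolding lin_ext_def
  by (rule sum.mono_neutral_left) (use assms in \<open>auto simp: in_keys_iff\<close>)

lemma linear_lin_ext: "linear (lin_ext f)"
proof (rule linearI)
  fix p q :: "'a \<Rightarrow>\<^sub>0 real" and r :: real
  let ?A = "Poly_Mapping.keys p \<union> Poly_Mapping.keys q"
  have "Poly_Mapping.keys (p + q) \<subseteq> ?A" by (rule Poly_Mapping.keys_add)
  then have "lin_ext f (p + q) = (\<Sum>k\<in>?A. Poly_Mapping.lookup (p + q) k *\<^sub>R f k)"
    by (intro lin_ext_superset) auto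
  also have "\<dots> = lin_ext f p + lin_ext f q"
    by (simp add: lookup_add scaleR_add_left sum.distrib lin_ext_superset[of ?A])
  finally show "lin_ext f (p + q) = lin_ext f p + lin_ext f q" .
  have "Poly_Mapping.keys (r *\<^sub>R p) \<subseteq> Poly_Mapping.keys p" by (auto simp: in_keys_iff)
  then have "lin_ext f (r *\<^sub>R p)
      = (\<Sum>k\<in>Poly_Mapping.keys p. Poly_Mapping.lookup (r *\<^sub>R p) k *\<^sub>R f k)"
    by (intro lin_ext_superset) auto
  then show "lin_ext f (r *\<^sub>R p) = r *\<^sub>R lin_ext f p"
    by (simp add: lin_ext_def scaleR_sum_right)
qed

lemma lin_ext_single [simp]: "lin_ext f (Poly_Mapping.single k r) = r *\<^sub>R f k"
  by (simp add: lin_ext_def)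

lemma lin_ext_single_id: "lin_ext (\<lambda>k. Poly_Mapping.single k 1) p = p"
proof (rule poly_mapping_eqI)
  fix k
  have "Poly_Mapping.lookup (lin_ext (\<lambda>k. Poly_Mapping.single k 1) p) k
     = (\<Sum>j\<in>Poly_Mapping.keys p. if j = k then Poly_Mapping.lookup p j else 0)"
    unfolding lin_ext_def lookup_sum by (intro sum.cong) (auto simp: lookup_single)
  also have "\<dots> = Poly_Mapping.lookup p k" by (simp add: in_keys_iff)
  finally show "Poly_Mapping.lookup (lin_ext (\<lambda>k. Poly_Mapping.single k 1) p) k
      = Poly_Mapping.lookup p k" .
qed

lemma linear_eq_0_on_span:
  assumes "linear f" "\<And>x. x \<in> B \<Longrightarrow> f x = 0" "x \<in> span B" shows "f x = 0"
  using linear_eq_on_span[of f "\<lambda>_. 0" B x] assms by (simp add: module_hom_zero)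

section \<open>Tensor products of real vector spaces and of unital real algebras\<close>

definition tensor_relators :: "('a::real_vector \<times> 'b::real_vector \<Rightarrow>\<^sub>0 real) set" where
  "tensor_relators =
     {Poly_Mapping.single (a + a', b) 1 - Poly_Mapping.single (a, b) 1
        - Poly_Mapping.single (a', b) 1 | a a' b. True}
   \<union> {Poly_Mapping.single (a, b + b') 1 - Poly_Mapping.single (a, b) 1
        - Poly_Mapping.single (a, b') 1 | a b b'. True}
   \<union> {Poly_Mapping.single (r *\<^sub>R a, b) 1 - r *\<^sub>R Poly_Mapping.single (a, b) 1 | r a b. True}
   \<union> {Poly_Mapping.single (a, r *\<^sub>R b) 1 - r *\<^sub>R Poly_Mapping.single (a, b) 1 | r a b. True}"

definition tensor_eq ::
  "('a::real_vector \<times> 'b::real_vector \<Rightarrow>\<^sub>0 real) \<Rightarrow> ('a \<times> 'b \<Rightarrow>\<^sub>0 real) \<Rightarrow> bool" where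
  "tensor_eq p q \<longleftrightarrow> p - q \<in> span tensor_relators"

lemma span_diff_equivp: "equivp (\<lambda>p q. p - q \<in> span B)"
proof (rule equivpI)
  show "reflp (\<lambda>p q. p - q \<in> span B)" by (auto simp: reflp_def span_zero)
  show "symp (\<lambda>p q. p - q \<in> span B)"
    by (rule sympI) (metis minus_diff_eq span_neg)
  show "transp (\<lambda>p q. p - q \<in> span B)"
  proof (rule transpI)
    fix x y z assume "x - y \<in> span B" "y - z \<in> span B"
    from span_add[OF this] show "x - z \<in> span B" by simp
  qed
qed

quotient_type (overloaded) ('a, 'b) tensor =
  "('a::real_vector) \<times> ('b::real_vector) \<Rightarrow>\<^sub>0 real" / tensor_eq
  unfolding tensor_eq_def by (rule span_diff_equivp)

lift_definition pure_tensor :: "'a::real_vector \<Rightarrow> 'b::real_vector \<Rightarrow> ('a, 'b) tensor"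
  (infixr \<open>\<otimes>\<close> 75) is "\<lambda>a b. Poly_Mapping.single (a, b) 1" .

instantiation tensor :: (real_vector, real_vector) real_vector
begin

lift_definition zero_tensor :: "('a, 'b) tensor" is 0 .
lift_definition plus_tensor :: "('a, 'b) tensor \<Rightarrow> ('a, 'b) tensor \<Rightarrow> ('a, 'b) tensor" is "(+)"
  unfolding tensor_eq_def by (auto simp: add_diff_add intro: span_add)
lift_definition uminus_tensor :: "('a, 'b) tensor \<Rightarrow> ('a, 'b) tensor" is uminus
  unfolding tensor_eq_def
proof -
  fix p q :: "'a \<times> 'b \<Rightarrow>\<^sub>0 real"
  assume "p - q \<in> span tensor_relators"
  from span_neg[OF this] show "- p - - q \<in> span tensor_relators" by simp
qed
lift_definition minus_tensor :: "('a, 'b) tensor \<Rightarrow> ('a, 'b) tensor \<Rightarrow> ('a, 'b) tensor" is "(-)"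
  unfolding tensor_eq_def
proof -
  fix p q p' q' :: "'a \<times> 'b \<Rightarrow>\<^sub>0 real"
  assume "p - q \<in> span tensor_relators" "p' - q' \<in> span tensor_relators"
  from span_diff[OF this] show "p - p' - (q - q') \<in> span tensor_relators"
    by (simp add: algebra_simps)
qed
lift_definition scaleR_tensor :: "real \<Rightarrow> ('a, 'b) tensor \<Rightarrow> ('a, 'b) tensor" is "(*\<^sub>R)"
  unfolding tensor_eq_def by (auto simp flip: scaleR_diff_right intro: span_scale)

instance
proof
  fix a b c :: "('a, 'b) tensor" and r s :: real
  show "a + b + c = a + (b + c)" by transfer (simp add: tensor_eq_def span_zero algebra_simps)
  show "a + b = b + a" by transfer (simp add: tensor_eq_def span_zero algebra_simps)
  show "0 + a = a" by transfer (simp add: tensor_eq_def span_zero)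
  show "- a + a = 0" by transfer (simp add: tensor_eq_def span_zero)
  show "a - b = a + - b" by transfer (simp add: tensor_eq_def span_zero)
  show "r *\<^sub>R (a + b) = r *\<^sub>R a + r *\<^sub>R b"
    by transfer (simp add: tensor_eq_def span_zero scaleR_add_right)
  show "(r + s) *\<^sub>R a = r *\<^sub>R a + s *\<^sub>R a"
    by transfer (simp add: tensor_eq_def span_zero scaleR_add_left)
  show "r *\<^sub>R s *\<^sub>R a = (r * s) *\<^sub>R a" by transfer (simp add: tensor_eq_def span_zero)
  show "1 *\<^sub>R a = a" by transfer (simp add: tensor_eq_def span_zero)
qed

end

definition tensor_lift ::
  "('a::real_vector \<Rightarrow> 'b::real_vector \<Rightarrow> 'c::real_vector) \<Rightarrow> ('a, 'b) tensor \<Rightarrow> 'c" where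
  "tensor_lift f t = lin_ext (\<lambda>(a, b). f a b) (rep_tensor t)"

lemma tensor_relator_eq: "p - q \<in> tensor_relators \<Longrightarrow> tensor_eq p q"
  unfolding tensor_eq_def by (rule span_base)

lemma bilinear_pure_tensor: "bilinear (\<otimes>)"
  unfolding bilinear_def
proof (intro conjI allI linearI)
  fix a a' :: 'a and b b' :: 'b and r :: real
  show "a \<otimes> (b + b') = a \<otimes> b + a \<otimes> b'"
    by (transfer, rule tensor_relator_eq, unfold tensor_relators_def diff_diff_eq[symmetric]) blast
  show "(a + a') \<otimes> b = a \<otimes> b + a' \<otimes> b"
    by (transfer, rule tensor_relator_eq, unfold tensor_relators_def diff_diff_eq[symmetric]) blast
  show "a \<otimes> (r *\<^sub>R b) = r *\<^sub>R (a \<otimes> b)"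
    by (transfer, rule tensor_relator_eq, unfold tensor_relators_def) blast
  show "(r *\<^sub>R a) \<otimes> b = r *\<^sub>R (a \<otimes> b)"
    by (transfer, rule tensor_relator_eq, unfold tensor_relators_def) blast
qed

lemma tensor_cases:
  obtains p where "t = abs_tensor p"
  using Quotient3_abs_rep[OF Quotient3_tensor] by metis

lemma tensor_lift_abs:
  assumes "bilinear f"
  shows "tensor_lift f (abs_tensor p) = lin_ext (\<lambda>(a, b). f a b) p"
proof -
  let ?L = "lin_ext (\<lambda>(a, b). f a b)"
  note lin = linear_lin_ext[of "\<lambda>(a, b). f a b"]
  have "tensor_eq (rep_tensor (abs_tensor p)) p"
    by (rule Quotient3_rep_abs[OF Quotient3_tensor]) (rule equivp_reflp[OF tensor_equivp])
  then have "?L (rep_tensor (abs_tensor p) - p) = 0"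
    unfolding tensor_eq_def
  proof (rule linear_eq_0_on_span[OF lin, rotated])
    fix x :: "'a \<times> 'b \<Rightarrow>\<^sub>0 real" assume "x \<in> tensor_relators"
    then show "?L x = 0"
      using assms unfolding tensor_relators_def
      by (auto simp: linear_diff[OF lin] linear_scale[OF lin]
          bilinear_ladd bilinear_radd bilinear_lmul bilinear_rmul)
  qed
  then show ?thesis by (simp add: tensor_lift_def linear_diff[OF lin])
qed

lemma tensor_lift_pure [simp]: "bilinear f \<Longrightarrow> tensor_lift f (a \<otimes> b) = f a b"
  by (simp add: pure_tensor.abs_eq tensor_lift_abs)

lemma linear_tensor_lift: "bilinear f \<Longrightarrow> linear (tensor_lift f)"
proof (rule linearI)
  assume f: "bilinear f"
  note lin = linear_lin_ext[of "\<lambda>(a, b). f a b"]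
  fix x y :: "('a, 'b) tensor" and r :: real
  show "tensor_lift f (x + y) = tensor_lift f x + tensor_lift f y"
    by (rule tensor_cases[of x], rule tensor_cases[of y])
       (simp add: plus_tensor.abs_eq tensor_lift_abs[OF f] linear_add[OF lin])
  show "tensor_lift f (r *\<^sub>R x) = r *\<^sub>R tensor_lift f x"
    by (rule tensor_cases[of x])
       (simp add: scaleR_tensor.abs_eq tensor_lift_abs[OF f] linear_scale[OF lin])
qed

lemma tensor_induct [case_names pure add]:
  assumes pure: "\<And>a b. P (a \<otimes> b)" and add: "\<And>x y. P x \<Longrightarrow> P y \<Longrightarrow> P (x + y)"
  shows "P t"
proof (rule tensor_cases[of t])
  fix p assume t: "t = abs_tensor p"
  have lin: "linear (abs_tensor :: _ \<Rightarrow> ('a, 'b) tensor)"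
    by (rule linearI) (simp_all add: plus_tensor.abs_eq scaleR_tensor.abs_eq)
  have z: "P 0" using pure[of 0 0] by (simp add: bilinear_lzero[OF bilinear_pure_tensor])
  have sum: "P (\<Sum>k\<in>A. (c k *\<^sub>R fst k) \<otimes> snd k)" if "finite A" for c A
    using that by induction (auto intro: z pure add)
  have "abs_tensor p = abs_tensor (lin_ext (\<lambda>k. Poly_Mapping.single k 1) p)"
    by (simp add: lin_ext_single_id)
  also have "\<dots> = (\<Sum>k\<in>Poly_Mapping.keys p.
      Poly_Mapping.lookup p k *\<^sub>R abs_tensor (Poly_Mapping.single k 1))"
    unfolding lin_ext_def by (simp add: linear_sum[OF lin] linear_scale[OF lin])
  also have "\<dots> = (\<Sum>k\<in>Poly_Mapping.keys p.
      (Poly_Mapping.lookup p k *\<^sub>R fst k) \<otimes> snd k)"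
    by (simp add: bilinear_lmul[OF bilinear_pure_tensor])
       (simp add: pure_tensor.abs_eq)
  finally show "P t" using sum[OF finite_keys] by (simp add: t)
qed

lemma tensor_linear_eqI:
  assumes "linear f" "linear g" "\<And>a b. f (a \<otimes> b) = g (a \<otimes> b)"
  shows "f t = g t"
  by (induct t rule: tensor_induct) (simp_all add: assms(3) linear_add[OF assms(1)] linear_add[OF assms(2)])

lemma linear_pure_left: "linear (\<lambda>a. a \<otimes> b)" and linear_pure_right: "linear (\<lambda>b. a \<otimes> b)"
  using bilinear_pure_tensor by (auto simp: bilinear_def)

lemmas pure_tensor_simps =
  bilinear_ladd[OF bilinear_pure_tensor] bilinear_radd[OF bilinear_pure_tensor]
  bilinear_lmul[OF bilinear_pure_tensor] bilinear_rmul[OF bilinear_pure_tensor]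
  bilinear_lzero[OF bilinear_pure_tensor] bilinear_rzero[OF bilinear_pure_tensor]
  bilinear_lneg[OF bilinear_pure_tensor] bilinear_rneg[OF bilinear_pure_tensor]

lemma bilinearI:
  assumes "\<And>x y z. f (x + y) z = f x z + f y z" "\<And>x y z. f x (y + z) = f x y + f x z"
    "\<And>r x y. f (r *\<^sub>R x) y = r *\<^sub>R f x y" "\<And>r x y. f x (r *\<^sub>R y) = r *\<^sub>R f x y"
  shows "bilinear f"
  unfolding bilinear_def using assms by (auto intro!: linearI)

lemma tensor_lift_fun_linear:
  assumes "\<And>a. bilinear (f a)" "\<And>b c. linear (\<lambda>a. f a b c)"
  shows "linear (\<lambda>a. tensor_lift (f a) t)"
proof (rule linearI)
  note f = linear_add[OF linear_tensor_lift[OF assms(1)]]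
  fix x y :: 'a and r :: real
  show "tensor_lift (f (x + y)) t = tensor_lift (f x) t + tensor_lift (f y) t"
  proof (induct t rule: tensor_induct)
    case (pure a b)
    show ?case unfolding tensor_lift_pure[OF assms(1)] by (rule linear_add[OF assms(2)])
  qed (simp add: f)
  show "tensor_lift (f (r *\<^sub>R x)) t = r *\<^sub>R tensor_lift (f x) t"
  proof (induct t rule: tensor_induct)
    case (pure a b)
    show ?case unfolding tensor_lift_pure[OF assms(1)] by (rule linear_scale[OF assms(2)])
  qed (simp add: f scaleR_add_right)
qed

lemma bilinear_tensor_factor:
  fixes a :: "'a::real_algebra_1" and b :: "'b::real_algebra_1"
  shows "bilinear (\<lambda>a' b'. (a * a') \<otimes> (b * b'))"
  by (rule bilinearI) (simp_all add: distrib_left pure_tensor_simps)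

lemma ex_linear_functional_one:
  "\<exists>\<phi> :: 'a::real_algebra_1 \<Rightarrow> real. linear \<phi> \<and> \<phi> 1 = 1"
proof -
  have "independent {1 :: 'a}" by simp
  from linear_independent_extend[OF this, of "\<lambda>_. 1 :: real"] show ?thesis by auto
qed

instantiation tensor :: (real_algebra_1, real_algebra_1) real_algebra_1
begin

definition one_tensor :: "('a, 'b) tensor" where "one_tensor = 1 \<otimes> 1"

definition times_tensor :: "('a, 'b) tensor \<Rightarrow> ('a, 'b) tensor \<Rightarrow> ('a, 'b) tensor" where
  "times_tensor t u = tensor_lift (\<lambda>a b. tensor_lift (\<lambda>a' b'. (a * a') \<otimes> (b * b')) u) t"

lemma bilinear_times_tensor_aux:
  "bilinear (\<lambda>a b. tensor_lift (\<lambda>a' b'. (a * a') \<otimes> (b * b')) (u :: ('a, 'b) tensor))"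
  unfolding bilinear_def
  by (intro conjI allI tensor_lift_fun_linear bilinear_tensor_factor linearI)
     (simp_all add: distrib_right pure_tensor_simps)

lemma pure_tensor_mult: "(a \<otimes> b) * (a' \<otimes> b') = (a * a') \<otimes> (b * b' :: 'b)" for a a' :: 'a
  unfolding times_tensor_def tensor_lift_pure[OF bilinear_times_tensor_aux]
  by (simp add: bilinear_tensor_factor)

lemma bilinear_times_tensor: "bilinear ((*) :: ('a, 'b) tensor \<Rightarrow> _)"
  unfolding bilinear_def
proof (intro conjI allI)
  fix t u :: "('a, 'b) tensor"
  show "linear (\<lambda>t. t * u)"
    unfolding times_tensor_def by (rule linear_tensor_lift[OF bilinear_times_tensor_aux])
  show "linear (\<lambda>u. t * u)"
  proof (induct t rule: tensor_induct)
    case (pure a b)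
    show ?case
      unfolding times_tensor_def tensor_lift_pure[OF bilinear_times_tensor_aux]
      by (rule linear_tensor_lift[OF bilinear_tensor_factor])
  next
    case (add x y)
    have "(x + y) * u = x * u + y * u" for u
      unfolding times_tensor_def by (rule linear_add[OF linear_tensor_lift[OF bilinear_times_tensor_aux]])
    then show ?case using linear_compose_add[OF add] by simp
  qed
qed

instance
proof
  fix a b c :: "('a, 'b) tensor" and r :: real
  note bil = bilinear_times_tensor
  show dr: "(a + b) * c = a * c + b * c" for a b c :: "('a, 'b) tensor"
    by (rule bilinear_ladd[OF bil])
  show dl: "a * (b + c) = a * b + a * c" for a b c :: "('a, 'b) tensor"
    by (rule bilinear_radd[OF bil])
  show "r *\<^sub>R a * b = r *\<^sub>R (a * b)" by (rule bilinear_lmul[OF bil])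
  show "a * r *\<^sub>R b = r *\<^sub>R (a * b)" by (rule bilinear_rmul[OF bil])
  show "1 * a = a"
    by (induct a rule: tensor_induct) (simp_all add: one_tensor_def pure_tensor_mult dl)
  show "a * 1 = a"
    by (induct a rule: tensor_induct) (simp_all add: one_tensor_def pure_tensor_mult dr)
  have 1: "a1 \<otimes> b1 * a2 \<otimes> b2 * c = a1 \<otimes> b1 * (a2 \<otimes> b2 * c)" for a1 a2 :: 'a and b1 b2 :: 'b
    by (induct c rule: tensor_induct) (simp_all add: pure_tensor_mult mult.assoc dl)
  have 2: "a1 \<otimes> b1 * b * c = a1 \<otimes> b1 * (b * c)" for a1 :: 'a and b1 :: 'b
    by (induct b rule: tensor_induct) (simp_all add: 1 dl dr)
  show "a * b * c = a * (b * c)"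
    by (induct a rule: tensor_induct) (simp_all add: 2 dl dr)
  obtain \<phi> :: "'a \<Rightarrow> real" where \<phi>: "linear \<phi>" "\<phi> 1 = 1"
    using ex_linear_functional_one by blast
  obtain \<psi> :: "'b \<Rightarrow> real" where \<psi>: "linear \<psi>" "\<psi> 1 = 1"
    using ex_linear_functional_one by blast
  have bl: "bilinear (\<lambda>a b. \<phi> a * \<psi> b)"
    using \<phi>(1) \<psi>(1) by (intro bilinearI) (simp_all add: linear_iff algebra_simps)
  have "tensor_lift (\<lambda>a b. \<phi> a * \<psi> b) (1 \<otimes> 1) = 1"
    using \<phi> \<psi> by (simp add: bl)
  then show "(0 :: ('a, 'b) tensor) \<noteq> 1"
    using linear_0[OF linear_tensor_lift[OF bl]] by (metis one_tensor_def zero_neq_one)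
qed

end

section \<open>The topologically free module $A[[h]]$\<close>

instantiation fps :: (real_vector) real_vector
begin
definition scaleR_fps :: "real \<Rightarrow> 'a fps \<Rightarrow> 'a fps" where
  "scaleR_fps r f = Abs_fps (\<lambda>n. r *\<^sub>R f $ n)"
instance
  by standard (simp_all add: scaleR_fps_def fps_eq_iff scaleR_add_left scaleR_add_right)
end

lemma scaleR_fps_nth [simp]: "(r *\<^sub>R f) $ n = r *\<^sub>R f $ n"
  by (simp add: scaleR_fps_def)

instance fps :: (real_algebra_1) real_algebra_1
  by standard (simp_all add: fps_eq_iff fps_mult_nth scaleR_sum_right)

definition fps_smult :: "real fps \<Rightarrow> 'a::real_vector fps \<Rightarrow> 'a fps" where
  "fps_smult s x = Abs_fps (\<lambda>n. \<Sum>i\<le>n. s $ i *\<^sub>R x $ (n - i))"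

lemma fps_smult_nth: "fps_smult s x $ n = (\<Sum>i\<le>n. s $ i *\<^sub>R x $ (n - i))"
  by (simp add: fps_smult_def)

lemma fps_smult_real [simp]: "fps_smult s x = s * x" for x :: "real fps"
  by (simp add: fps_eq_iff fps_smult_nth fps_mult_nth atLeast0AtMost)

interpretation fps_module: module "fps_smult :: real fps \<Rightarrow> 'a::real_vector fps \<Rightarrow> 'a fps"
proof
  fix a b :: "real fps" and x y :: "'a fps"
  show "fps_smult a (x + y) = fps_smult a x + fps_smult a y"
    by (simp add: fps_eq_iff fps_smult_nth scaleR_add_right sum.distrib)
  show "fps_smult (a + b) x = fps_smult a x + fps_smult b x"
    by (simp add: fps_eq_iff fps_smult_nth scaleR_add_left sum.distrib)
  show "fps_smult 1 x = x"
    by (simp add: fps_eq_iff fps_smult_nth if_distrib[of "\<lambda>r. r *\<^sub>R _"] cong: if_cong)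
  show "fps_smult a (fps_smult b x) = fps_smult (a * b) x"
  proof (rule fps_ext)
    fix n
    have "fps_smult a (fps_smult b x) $ n
        = (\<Sum>i\<le>n. \<Sum>j\<le>n - i. (a $ i * b $ j) *\<^sub>R x $ (n - i - j))"
      by (simp add: fps_smult_nth scaleR_sum_right)
    also have "\<dots> = (\<Sum>k\<le>n. \<Sum>i\<le>k. (a $ i * b $ (k - i)) *\<^sub>R x $ (n - k))"
    proof -
      have "(\<Sum>i\<le>n. \<Sum>j\<le>n - i. (a $ i * b $ j) *\<^sub>R x $ (n - i - j))
          = (\<Sum>(i, j)\<in>{(i, j). i + j \<le> n}. (a $ i * b $ j) *\<^sub>R x $ (n - (i + j)))"
        by (subst sum.Sigma) (auto intro!: sum.cong)
      also have "\<dots> = (\<Sum>k\<le>n. \<Sum>i\<le>k. (a $ i * b $ (k - i)) *\<^sub>R x $ (n - (i + (k - i))))"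
        by (rule sum.triangle_reindex_eq)
      finally show ?thesis by simp
    qed
    also have "\<dots> = fps_smult (a * b) x $ n"
      by (simp add: fps_smult_nth fps_mult_nth scaleR_sum_left atLeast0AtMost)
    finally show "fps_smult a (fps_smult b x) $ n = fps_smult (a * b) x $ n" .
  qed
qed

abbreviation fps_linear :: "('a::real_vector fps \<Rightarrow> 'b::real_vector fps) \<Rightarrow> bool" where
  "fps_linear \<equiv> module_hom fps_smult fps_smult"

definition fps_algebra_hom ::
  "('a::real_algebra_1 fps \<Rightarrow> 'b::real_algebra_1 fps) \<Rightarrow> bool" where
  "fps_algebra_hom F \<longleftrightarrow> fps_linear F \<and> F 1 = 1 \<and> (\<forall>x y. F (x * y) = F x * F y)"

text \<open>
  An \<open>\<real>[[h]]\<close>-linear map between topologically free modules is automatically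
  \<open>h\<close>-adically continuous, so it is determined by its values on constant series. The map
  \<open>fps_extend \<phi>\<close> is the one that restricts to a given linear map \<open>\<phi> : A \<rightarrow> B[[h]]\<close>.
\<close>

definition fps_extend :: "('a::real_vector \<Rightarrow> 'b::real_vector fps) \<Rightarrow> 'a fps \<Rightarrow> 'b fps" where
  "fps_extend \<phi> x = Abs_fps (\<lambda>n. \<Sum>i\<le>n. \<phi> (x $ i) $ (n - i))"

section \<open>Completed tensor products over $R[[h]]$\<close>

text \<open>
  The completed tensor product of \<open>A[[h]]\<close> and \<open>B[[h]]\<close> over \<open>\<real>[[h]]\<close> is
  \<open>(A \<otimes> B)[[h]]\<close>, that is, the type \<open>('a, 'b) tensor fps\<close>. If \<open>f\<close> is
  \<open>\<real>[[h]]\<close>-bilinear, then \<open>fps_tensor_lift f\<close> is the \<open>\<real>[[h]]\<close>-linear map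
  with \<open>x \<otimes>\<^sub>h y \<mapsto> f x y\<close>.
\<close>

definition fps_pure_tensor ::
  "'a::real_vector fps \<Rightarrow> 'b::real_vector fps \<Rightarrow> ('a, 'b) tensor fps" (infixr \<open>\<otimes>\<^sub>h\<close> 75) where
  "x \<otimes>\<^sub>h y = Abs_fps (\<lambda>n. \<Sum>i\<le>n. x $ i \<otimes> y $ (n - i))"

definition fps_tensor_lift ::
  "('a::real_vector fps \<Rightarrow> 'b::real_vector fps \<Rightarrow> 'c::real_vector fps)
     \<Rightarrow> ('a, 'b) tensor fps \<Rightarrow> 'c fps" where
  "fps_tensor_lift f = fps_extend (tensor_lift (\<lambda>a b. f (fps_const a) (fps_const b)))"

definition fps_tensor_map ::
  "('a::real_vector fps \<Rightarrow> 'c::real_vector fps) \<Rightarrow> ('b::real_vector fps \<Rightarrow> 'd::real_vector fps)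
     \<Rightarrow> ('a, 'b) tensor fps \<Rightarrow> ('c, 'd) tensor fps" where
  "fps_tensor_map F G = fps_tensor_lift (\<lambda>x y. F x \<otimes>\<^sub>h G y)"

definition fps_flip :: "('a::real_vector, 'b::real_vector) tensor fps \<Rightarrow> ('b, 'a) tensor fps" where
  "fps_flip = fps_tensor_lift (\<lambda>x y. y \<otimes>\<^sub>h x)"

definition fps_assoc ::
  "(('a::real_vector, 'b::real_vector) tensor, 'c::real_vector) tensor fps
     \<Rightarrow> ('a, ('b, 'c) tensor) tensor fps" where
  "fps_assoc = fps_tensor_lift (\<lambda>t z. fps_tensor_lift (\<lambda>x y. x \<otimes>\<^sub>h y \<otimes>\<^sub>h z) t)"

text \<open>Threefold tensor products are bracketed to the right throughout.\<close>

definition leg12 ::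
  "('a::real_algebra_1, 'a) tensor fps \<Rightarrow> ('a, ('a, 'a) tensor) tensor fps" where
  "leg12 = fps_tensor_lift (\<lambda>x y. x \<otimes>\<^sub>h y \<otimes>\<^sub>h 1)"

definition leg13 ::
  "('a::real_algebra_1, 'a) tensor fps \<Rightarrow> ('a, ('a, 'a) tensor) tensor fps" where
  "leg13 = fps_tensor_lift (\<lambda>x y. x \<otimes>\<^sub>h 1 \<otimes>\<^sub>h y)"

definition leg23 ::
  "('a::real_algebra_1, 'a) tensor fps \<Rightarrow> ('a, ('a, 'a) tensor) tensor fps" where
  "leg23 = fps_tensor_lift (\<lambda>x y. 1 \<otimes>\<^sub>h x \<otimes>\<^sub>h y)"

definition fps_wedge :: "'a::real_vector fps \<Rightarrow> 'a fps \<Rightarrow> ('a, 'a) tensor fps" (infix \<open>\<and>\<^sub>h\<close> 75) where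
  "x \<and>\<^sub>h y = x \<otimes>\<^sub>h y - y \<otimes>\<^sub>h x"

section \<open>Topological Hopf algebras and universal $R$-matrices\<close>

locale topological_hopf_algebra =
  fixes comult :: "'a::real_algebra_1 fps \<Rightarrow> ('a, 'a) tensor fps"
    and counit :: "'a fps \<Rightarrow> real fps"
    and antipode :: "'a fps \<Rightarrow> 'a fps"
  assumes comult_hom: "fps_algebra_hom comult"
    and counit_hom: "fps_algebra_hom counit"
    and antipode_linear: "fps_linear antipode"
    and coassoc: "fps_assoc (fps_tensor_map comult id (comult x)) = fps_tensor_map id comult (comult x)"
    and counit_left: "fps_tensor_lift (\<lambda>y z. fps_smult (counit y) z) (comult x) = x"
    and counit_right: "fps_tensor_lift (\<lambda>y z. fps_smult (counit z) y) (comult x) = x"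
    and antipode_left: "fps_tensor_lift (\<lambda>y z. antipode y * z) (comult x) = fps_smult (counit x) 1"
    and antipode_right: "fps_tensor_lift (\<lambda>y z. y * antipode z) (comult x) = fps_smult (counit x) 1"

definition two_sided_inverse :: "'a::monoid_mult \<Rightarrow> 'a \<Rightarrow> bool" where
  "two_sided_inverse x y \<longleftrightarrow> x * y = 1 \<and> y * x = 1"

definition ring_inverse :: "'a::monoid_mult \<Rightarrow> 'a" where
  "ring_inverse x = (THE y. two_sided_inverse x y)"

definition universal_R_matrix ::
  "('a::real_algebra_1 fps \<Rightarrow> ('a, 'a) tensor fps) \<Rightarrow> ('a, 'a) tensor fps \<Rightarrow> bool" where
  "universal_R_matrix \<Delta> R \<longleftrightarrow>
     (\<exists>R'. two_sided_inverse R R')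
   \<and> (\<forall>X. R * \<Delta> X * ring_inverse R = fps_flip (\<Delta> X))
   \<and> fps_assoc (fps_tensor_map \<Delta> id R) = leg13 R * leg23 R
   \<and> fps_tensor_map id \<Delta> R = leg13 R * leg12 R"

definition triangular_R_matrix ::
  "('a::real_algebra_1 fps \<Rightarrow> ('a, 'a) tensor fps) \<Rightarrow> ('a, 'a) tensor fps \<Rightarrow> bool" where
  "triangular_R_matrix \<Delta> R \<longleftrightarrow> universal_R_matrix \<Delta> R \<and> fps_flip R = ring_inverse R"

text \<open>The first-order term of \<open>R\<close>, including the factor \<open>h\<close>.\<close>

definition classical_r_matrix :: "('a::real_algebra_1, 'a) tensor fps \<Rightarrow> ('a, 'a) tensor fps" where
  "classical_r_matrix R = fps_X * fps_const (R $ 1)"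

text \<open>The sum is taken in the \<open>h\<close>-adic topology; it converges whenever \<open>a $ 0 = 0\<close>.\<close>

definition formal_exp :: "'a::real_algebra_1 fps \<Rightarrow> 'a fps" where
  "formal_exp a = suminf (\<lambda>k. (1 / fact k) *\<^sub>R a ^ k)"

section \<open>The enveloping algebra of the Schroedinger algebra\<close>

instantiation list :: (type) monoid_add
begin
definition zero_list :: "'a list" where "zero_list = []"
definition plus_list :: "'a list \<Rightarrow> 'a list \<Rightarrow> 'a list" where "plus_list = (@)"
instance by standard (simp_all add: zero_list_def plus_list_def)
end

datatype schroedinger_gen = Dg | Hg | Pg | Kg | Cg | Mg

text \<open>
  With concatenation as addition of words, the convolution product of \<open>poly_mapping\<close>
  makes \<open>schroedinger_gen list \<Rightarrow>\<^sub>0 real\<close> the free unital algebra on the generators.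
\<close>

type_synonym free_schroedinger = "schroedinger_gen list \<Rightarrow>\<^sub>0 real"

abbreviation free_gen :: "schroedinger_gen \<Rightarrow> free_schroedinger" where
  "free_gen g \<equiv> Poly_Mapping.single [g] 1"

definition commutator :: "'a::ring \<Rightarrow> 'a \<Rightarrow> 'a" where
  "commutator x y = x * y - y * x"

definition schroedinger_relators :: "free_schroedinger set" where
  "schroedinger_relators =
     (let D = free_gen Dg; H = free_gen Hg; P = free_gen Pg;
          K = free_gen Kg; C = free_gen Cg; M = free_gen Mg in
      {commutator D P - (- P),
       commutator D K - K,
       commutator K P - M,
       commutator D H - (- (2 * H)),
       commutator D C - 2 * C,
       commutator H C - D,
       commutator K H - P,
       commutator K C - 0,
       commutator P C - (- K),
       commutator P H - 0}
      \<union> {commutator M (free_gen g) - 0 | g. True})"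

definition schroedinger_ideal :: "free_schroedinger set" where
  "schroedinger_ideal = span {p * r * q | p r q. r \<in> schroedinger_relators}"

definition schroedinger_eq :: "free_schroedinger \<Rightarrow> free_schroedinger \<Rightarrow> bool" where
  "schroedinger_eq p q \<longleftrightarrow> p - q \<in> schroedinger_ideal"

quotient_type schroedinger = free_schroedinger / schroedinger_eq
  unfolding schroedinger_eq_def schroedinger_ideal_def by (rule span_diff_equivp)

lemma scaleR_conv_single_left: "r *\<^sub>R p = Poly_Mapping.single [] r * p"
  for p :: free_schroedinger
proof -
  have "Poly_Mapping.single [] r * p = Poly_Mapping.map ((*) r) p"
    using mult_map_scale_conv_mult[of r p] by (simp add: zero_list_def)
  also have "\<dots> = r *\<^sub>R p"
    by (rule poly_mapping_eqI) (simp add: Poly_Mapping.map.rep_eq when_def)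
  finally show ?thesis by simp
qed

lemma free_mult_scaleR_left: "r *\<^sub>R p * q = r *\<^sub>R (p * q)" for p q :: free_schroedinger
  by (simp add: scaleR_conv_single_left mult.assoc)

lemma free_mult_scaleR_right: "p * r *\<^sub>R q = r *\<^sub>R (p * q)" for p q :: free_schroedinger
proof -
  have "linear (\<lambda>p :: free_schroedinger. p * Poly_Mapping.single [] r)"
    by (rule linearI) (simp_all add: distrib_right free_mult_scaleR_left)
  from linear_sum[OF this]
  have "lin_ext (\<lambda>k. Poly_Mapping.single k 1) p * Poly_Mapping.single [] r
      = (\<Sum>k\<in>Poly_Mapping.keys p.
          (Poly_Mapping.lookup p k *\<^sub>R Poly_Mapping.single k 1) * Poly_Mapping.single [] r)"
    by (simp add: lin_ext_def)
  also have "\<dots> = (\<Sum>k\<in>Poly_Mapping.keys p.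
          r *\<^sub>R (Poly_Mapping.lookup p k *\<^sub>R Poly_Mapping.single k 1))"
    by (intro sum.cong) (simp_all add: scaleR_conv_single_left mult_single plus_list_def mult.commute)
  also have "\<dots> = r *\<^sub>R lin_ext (\<lambda>k. Poly_Mapping.single k 1) p"
    by (simp add: lin_ext_def scaleR_sum_right)
  finally have "p * Poly_Mapping.single [] r = r *\<^sub>R p" by (simp add: lin_ext_single_id)
  then show ?thesis
    by (metis scaleR_conv_single_left mult.assoc)
qed

lemma linear_free_mult_left: "linear (\<lambda>p :: free_schroedinger. p * q)"
  and linear_free_mult_right: "linear (\<lambda>q :: free_schroedinger. p * q)"
  by (auto intro!: linearI
      simp: distrib_left distrib_right free_mult_scaleR_left free_mult_scaleR_right)

lemma linear_span_mono:
  assumes "linear f" "f ` B \<subseteq> span B" "x \<in> span B" shows "f x \<in> span B"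
proof -
  have "f x \<in> span (f ` B)" using assms(3) by (simp add: linear_span_image[OF assms(1)])
  also have "span (f ` B) \<subseteq> span B" by (rule span_minimal[OF assms(2)]) simp
  finally show ?thesis .
qed

lemma schroedinger_ideal_mult:
  assumes "x \<in> schroedinger_ideal"
  shows "x * q \<in> schroedinger_ideal" "p * x \<in> schroedinger_ideal"
proof -
  let ?B = "{p * r * q | p r q. r \<in> schroedinger_relators}"
  have "(\<lambda>x. x * q) ` ?B \<subseteq> ?B"
  proof (rule image_subsetI)
    fix x assume "x \<in> ?B"
    then obtain p' r q' where "x = p' * r * q'" and r: "r \<in> schroedinger_relators" by blast
    then have "x * q = p' * r * (q' * q)" by (simp add: mult.assoc)
    then show "x * q \<in> ?B" using r by blast
  qed
  from linear_span_mono[OF linear_free_mult_left order_trans[OF this span_superset]]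
  show "x * q \<in> schroedinger_ideal" using assms unfolding schroedinger_ideal_def .
  have "(\<lambda>x. p * x) ` ?B \<subseteq> ?B"
  proof (rule image_subsetI)
    fix x assume "x \<in> ?B"
    then obtain p' r q' where "x = p' * r * q'" and r: "r \<in> schroedinger_relators" by blast
    then have "p * x = (p * p') * r * q'" by (simp add: mult.assoc)
    then show "p * x \<in> ?B" using r by blast
  qed
  from linear_span_mono[OF linear_free_mult_right order_trans[OF this span_superset]]
  show "p * x \<in> schroedinger_ideal" using assms unfolding schroedinger_ideal_def .
qed

lemma scaleR_single: "r *\<^sub>R Poly_Mapping.single k s = Poly_Mapping.single k (r * s)" for s :: real
  by (rule poly_mapping_eqI) (simp add: lookup_single when_def)

lemma lookup_mult_Nil:
  "Poly_Mapping.lookup (p * q) [] = Poly_Mapping.lookup p [] * Poly_Mapping.lookup q []"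
  for p q :: free_schroedinger
proof -
  have "Poly_Mapping.lookup (lin_ext (\<lambda>k. Poly_Mapping.single k (1::real)) p
        * lin_ext (\<lambda>k. Poly_Mapping.single k (1::real)) q) []
      = lin_ext (\<lambda>k. if k = [] then 1 else 0) p * lin_ext (\<lambda>k. if k = [] then 1 else 0) q"
    unfolding lin_ext_def sum_product lookup_sum scaleR_single mult_single
    by (intro sum.cong refl) (simp add: lookup_single when_def plus_list_def)
  moreover have "lin_ext (\<lambda>k. if k = [] then 1 else 0) p = Poly_Mapping.lookup p []"
    for p :: free_schroedinger
    unfolding lin_ext_def by (simp add: if_distrib in_keys_iff cong: if_cong)
  ultimately show ?thesis by (simp add: lin_ext_single_id)
qed

lemma one_notin_schroedinger_ideal: "1 \<notin> schroedinger_ideal"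
proof
  let ?\<epsilon> = "\<lambda>p :: free_schroedinger. Poly_Mapping.lookup p []"
  assume "1 \<in> schroedinger_ideal"
  moreover have "linear ?\<epsilon>" by (rule linearI) (simp_all add: lookup_add)
  moreover have "?\<epsilon> (p * r * q) = 0" if "r \<in> schroedinger_relators" for p r q
    using that unfolding schroedinger_relators_def Let_def commutator_def
    by (auto simp: lookup_mult_Nil lookup_minus lookup_add lookup_single when_def)
  ultimately have "?\<epsilon> 1 = 0"
    unfolding schroedinger_ideal_def by (elim linear_eq_0_on_span[rotated 2]) auto
  then show False by (simp add: lookup_one zero_list_def)
qed

instantiation schroedinger :: real_algebra_1
begin

lift_definition zero_schroedinger :: schroedinger is 0 .
lift_definition one_schroedinger :: schroedinger is 1 .
lift_definition plus_schroedinger :: "schroedinger \<Rightarrow> schroedinger \<Rightarrow> schroedinger" is "(+)"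
  unfolding schroedinger_eq_def schroedinger_ideal_def by (auto simp: add_diff_add intro: span_add)
lift_definition uminus_schroedinger :: "schroedinger \<Rightarrow> schroedinger" is uminus
  unfolding schroedinger_eq_def
proof -
  fix p q :: free_schroedinger
  assume "p - q \<in> schroedinger_ideal"
  then show "- p - - q \<in> schroedinger_ideal"
    unfolding schroedinger_ideal_def using span_neg by fastforce
qed
lift_definition minus_schroedinger :: "schroedinger \<Rightarrow> schroedinger \<Rightarrow> schroedinger" is "(-)"
  unfolding schroedinger_eq_def
proof -
  fix p q p' q' :: free_schroedinger
  assume "p - q \<in> schroedinger_ideal" "p' - q' \<in> schroedinger_ideal"
  then have "(p - q) - (p' - q') \<in> schroedinger_ideal"
    unfolding schroedinger_ideal_def by (rule span_diff)
  then show "p - p' - (q - q') \<in> schroedinger_ideal" by (simp add: algebra_simps)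
qed
lift_definition scaleR_schroedinger :: "real \<Rightarrow> schroedinger \<Rightarrow> schroedinger" is "(*\<^sub>R)"
  unfolding schroedinger_eq_def schroedinger_ideal_def
  by (auto simp flip: scaleR_diff_right intro: span_scale)
lift_definition times_schroedinger :: "schroedinger \<Rightarrow> schroedinger \<Rightarrow> schroedinger" is "(*)"
  unfolding schroedinger_eq_def
proof -
  fix p q p' q' :: free_schroedinger
  assume "p - q \<in> schroedinger_ideal" "p' - q' \<in> schroedinger_ideal"
  then have "(p - q) * p' + q * (p' - q') \<in> schroedinger_ideal"
    using schroedinger_ideal_mult unfolding schroedinger_ideal_def by (blast intro: span_add)
  then show "p * p' - q * q' \<in> schroedinger_ideal" by (simp add: algebra_simps)
qed

instance
proof
  have refl: "schroedinger_eq p q" if "p = q" for p q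
    using that by (simp add: schroedinger_eq_def schroedinger_ideal_def span_zero)
  fix a b c :: schroedinger and r s :: real
  show "a + b + c = a + (b + c)" by transfer (rule refl, simp add: algebra_simps)
  show "a + b = b + a" by transfer (rule refl, simp add: algebra_simps)
  show "0 + a = a" by transfer (rule refl, simp)
  show "- a + a = 0" by transfer (rule refl, simp)
  show "a - b = a + - b" by transfer (rule refl, simp)
  show "r *\<^sub>R (a + b) = r *\<^sub>R a + r *\<^sub>R b" by transfer (rule refl, simp add: scaleR_add_right)
  show "(r + s) *\<^sub>R a = r *\<^sub>R a + s *\<^sub>R a" by transfer (rule refl, simp add: scaleR_add_left)
  show "r *\<^sub>R s *\<^sub>R a = (r * s) *\<^sub>R a" by transfer (rule refl, simp)
  show "1 *\<^sub>R a = a" by transfer (rule refl, simp)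
  show "a * b * c = a * (b * c)" by transfer (rule refl, simp add: mult.assoc)
  show "(a + b) * c = a * c + b * c" by transfer (rule refl, simp add: distrib_right)
  show "a * (b + c) = a * b + a * c" by transfer (rule refl, simp add: distrib_left)
  show "1 * a = a" by transfer (rule refl, simp)
  show "a * 1 = a" by transfer (rule refl, simp)
  show "r *\<^sub>R a * b = r *\<^sub>R (a * b)" by transfer (rule refl, rule free_mult_scaleR_left)
  show "a * r *\<^sub>R b = r *\<^sub>R (a * b)" by transfer (rule refl, rule free_mult_scaleR_right)
  show "(0 :: schroedinger) \<noteq> 1"
  proof transfer
    show "\<not> schroedinger_eq 0 1"
    proof
      assume "schroedinger_eq 0 1"
      then have "- (0 - 1) \<in> schroedinger_ideal"
        unfolding schroedinger_eq_def schroedinger_ideal_def by (rule span_neg)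
      then show False using one_notin_schroedinger_ideal by simp
    qed
  qed
qed

end

lift_definition schroedinger_of_gen :: "schroedinger_gen \<Rightarrow> schroedinger" is free_gen .

definition gen :: "schroedinger_gen \<Rightarrow> schroedinger fps" where
  "gen g = fps_const (schroedinger_of_gen g)"

text \<open>The deformation parameter \<open>c\<^sub>1\<close> is the formal variable.\<close>

abbreviation c1 :: "'a::ring_1 fps" where "c1 \<equiv> fps_X"

section \<open>Existence of the Hopf algebra structure\<close>

text \<open>
  The final theorem of this section, \<open>ex_schroedinger_hopf_algebra\<close>, shows that the
  prescribed coproduct respects the commutation rules and is part of a Hopf algebra structure.
\<close>

subsection \<open>Linear maps over $R[[h]]$\<close>

lemma fps_linear_iff:
  "fps_linear F \<longleftrightarrow>
     (\<forall>x y. F (x + y) = F x + F y) \<and> (\<forall>s x. F (fps_smult s x) = fps_smult s (F x))"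
  by (auto simp: module_hom_iff fps_module.module_axioms)

lemma fps_linearI:
  assumes "\<And>x y. F (x + y) = F x + F y" "\<And>s x. F (fps_smult s x) = fps_smult s (F x)"
  shows "fps_linear F"
  using assms by (simp add: fps_linear_iff)

lemma fps_linear_add: "fps_linear F \<Longrightarrow> F (x + y) = F x + F y"
  and fps_linear_smult: "fps_linear F \<Longrightarrow> F (fps_smult s x) = fps_smult s (F x)"
  by (auto simp: fps_linear_iff)

lemma fps_smult_const: "fps_smult (fps_const r) x = r *\<^sub>R x"
proof (rule fps_ext)
  fix n
  have "fps_smult (fps_const r) x $ n = (\<Sum>i\<le>n. if i = 0 then r *\<^sub>R x $ n else 0)"
    unfolding fps_smult_nth by (intro sum.cong) auto
  then show "fps_smult (fps_const r) x $ n = (r *\<^sub>R x) $ n" by simp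
qed

lemma fps_smult_X_power_nth:
  "fps_smult (fps_X ^ k) x $ n = (if n < k then 0 else x $ (n - k))"
proof -
  have "fps_smult (fps_X ^ k) x $ n = (\<Sum>i\<le>n. if i = k then x $ (n - k) else 0)"
    unfolding fps_smult_nth by (intro sum.cong) (auto simp: fps_X_power_nth)
  then show ?thesis by auto
qed

lemma fps_linear_scaleR: "fps_linear F \<Longrightarrow> F (r *\<^sub>R x) = r *\<^sub>R F x"
  by (metis fps_linear_smult fps_smult_const)

lemma fps_linear_0: "fps_linear F \<Longrightarrow> F 0 = 0"
  using fps_linear_scaleR[of F 0 0] by simp

lemma fps_linear_minus: "fps_linear F \<Longrightarrow> F (- x) = - F x"
  using fps_linear_scaleR[of F "-1" x] by simp

lemma fps_linear_diff: "fps_linear F \<Longrightarrow> F (x - y) = F x - F y"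
  using fps_linear_add[of F x "- y"] by (simp add: fps_linear_minus)

lemma fps_linear_sum: "fps_linear F \<Longrightarrow> F (\<Sum>i\<in>A. g i) = (\<Sum>i\<in>A. F (g i))"
  by (induct A rule: infinite_finite_induct) (simp_all add: fps_linear_0 fps_linear_add)

lemma fps_linear_const: "fps_linear F \<Longrightarrow> linear (\<lambda>a. F (fps_const a))"
  for F :: "'a::real_vector fps \<Rightarrow> 'b::real_vector fps"
proof (rule linearI)
  assume F: "fps_linear F"
  fix a b :: 'a and r :: real
  have "fps_const (a + b) = fps_const a + fps_const b" by simp
  then show "F (fps_const (a + b)) = F (fps_const a) + F (fps_const b)"
    by (metis fps_linear_add[OF F])
  have "fps_const (r *\<^sub>R a) = r *\<^sub>R fps_const a" by (simp add: fps_eq_iff)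
  then show "F (fps_const (r *\<^sub>R a)) = r *\<^sub>R F (fps_const a)"
    by (metis fps_linear_scaleR[OF F])
qed

lemma fps_linear_eq_extend:
  assumes F: "fps_linear F" shows "F x = fps_extend (\<lambda>a. F (fps_const a)) x"
proof (rule fps_ext)
  fix n
  let ?y = "Abs_fps (\<lambda>m. x $ (m + Suc n))"
  have x: "x = (\<Sum>i\<le>n. fps_smult (fps_X ^ i) (fps_const (x $ i))) + fps_smult (fps_X ^ Suc n) ?y"
  proof (rule fps_ext)
    fix m
    have *: "(\<Sum>i\<le>n. fps_smult (fps_X ^ i) (fps_const (x $ i)) $ m)
        = (\<Sum>i\<le>n. if i = m then x $ m else 0)"
      by (intro sum.cong) (auto simp: fps_smult_X_power_nth)
    show "x $ m = ((\<Sum>i\<le>n. fps_smult (fps_X ^ i) (fps_const (x $ i)))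
        + fps_smult (fps_X ^ Suc n) ?y) $ m"
      by (simp add: fps_sum_nth * del: power_Suc)
         (simp add: fps_smult_X_power_nth del: power_Suc)
  qed
  have "F x $ n = ((\<Sum>i\<le>n. fps_smult (fps_X ^ i) (F (fps_const (x $ i))))
      + fps_smult (fps_X ^ Suc n) (F ?y)) $ n"
    by (subst x) (simp add: fps_linear_add[OF F] fps_linear_sum[OF F] fps_linear_smult[OF F]
        del: power_Suc)
  also have "\<dots> = (\<Sum>i\<le>n. F (fps_const (x $ i)) $ (n - i))"
    by (simp add: fps_sum_nth fps_smult_X_power_nth del: power_Suc)
  finally show "F x $ n = fps_extend (\<lambda>a. F (fps_const a)) x $ n"
    by (simp add: fps_extend_def)
qed

lemma fps_linear_eqI:
  assumes "fps_linear F" "fps_linear G" "\<And>a. F (fps_const a) = G (fps_const a)"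
  shows "F x = G x"
  using fps_linear_eq_extend[OF assms(1), of x] fps_linear_eq_extend[OF assms(2), of x] assms(3)
  by simp

lemma fps_extend_const [simp]: "\<phi> 0 = 0 \<Longrightarrow> fps_extend \<phi> (fps_const a) = \<phi> a"
proof (rule fps_ext)
  fix n assume "\<phi> 0 = 0"
  then have "fps_extend \<phi> (fps_const a) $ n = (\<Sum>i\<le>n. if i = 0 then \<phi> a $ n else 0)"
    unfolding fps_extend_def fps_nth_Abs_fps by (intro sum.cong) auto
  then show "fps_extend \<phi> (fps_const a) $ n = \<phi> a $ n" by simp
qed

lemma sum_triangle_swap:
  fixes g :: "nat \<Rightarrow> nat \<Rightarrow> nat \<Rightarrow> 'a::comm_monoid_add"
  shows "(\<Sum>i\<le>n. \<Sum>j\<le>i. g j (i - j) (n - i)) = (\<Sum>j\<le>n. \<Sum>i\<le>n - j. g j i (n - j - i))"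
proof -
  have "(\<Sum>j\<le>n. \<Sum>i\<le>n - j. g j i (n - j - i))
      = (\<Sum>(j, i)\<in>{(j, i). j + i \<le> n}. g j i (n - (j + i)))"
    by (subst sum.Sigma) (auto intro!: sum.cong)
  also have "\<dots> = (\<Sum>k\<le>n. \<Sum>j\<le>k. g j (k - j) (n - (j + (k - j))))"
    by (rule sum.triangle_reindex_eq)
  finally show ?thesis by simp
qed

lemma fps_linear_extend:
  assumes "linear \<phi>" shows "fps_linear (fps_extend \<phi>)"
proof (rule fps_linearI)
  fix x y :: "'a fps" and s :: "real fps"
  show "fps_extend \<phi> (x + y) = fps_extend \<phi> x + fps_extend \<phi> y"
    by (simp add: fps_eq_iff fps_extend_def linear_add[OF assms] sum.distrib)
  show "fps_extend \<phi> (fps_smult s x) = fps_smult s (fps_extend \<phi> x)"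
  proof (rule fps_ext)
    fix n
    have sum_nth: "(\<Sum>j\<in>A. f j) $ m = (\<Sum>j\<in>A. f j $ m)" for A m and f :: "nat \<Rightarrow> 'b fps"
      by (simp add: fps_sum_nth)
    have "fps_extend \<phi> (fps_smult s x) $ n
        = (\<Sum>i\<le>n. \<Sum>j\<le>i. s $ j *\<^sub>R \<phi> (x $ (i - j)) $ (n - i))"
      by (simp add: fps_extend_def fps_smult_nth linear_sum[OF assms] linear_scale[OF assms] sum_nth)
    also have "\<dots> = (\<Sum>j\<le>n. \<Sum>i\<le>n - j. s $ j *\<^sub>R \<phi> (x $ i) $ (n - j - i))"
      by (rule sum_triangle_swap[of "\<lambda>j i k. s $ j *\<^sub>R \<phi> (x $ i) $ k"])
    also have "\<dots> = fps_smult s (fps_extend \<phi> x) $ n"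
      by (simp add: fps_extend_def fps_smult_nth scaleR_sum_right)
    finally show "fps_extend \<phi> (fps_smult s x) $ n = fps_smult s (fps_extend \<phi> x) $ n" .
  qed
qed

lemma fps_linear_ident: "fps_linear (\<lambda>x. x)" "fps_linear id"
  by (auto intro: fps_linearI)

lemma fps_linear_compose: "fps_linear F \<Longrightarrow> fps_linear G \<Longrightarrow> fps_linear (\<lambda>x. F (G x))"
  by (simp add: fps_linear_iff)

lemma fps_linear_plus: "fps_linear F \<Longrightarrow> fps_linear G \<Longrightarrow> fps_linear (\<lambda>x. F x + G x)"
  unfolding fps_linear_iff by (simp add: fps_module.scale_right_distrib ac_simps)

subsection \<open>Bilinear maps\<close>

definition fps_bilinear ::
  "('a::real_vector fps \<Rightarrow> 'b::real_vector fps \<Rightarrow> 'c::real_vector fps) \<Rightarrow> bool" where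
  "fps_bilinear f \<longleftrightarrow> (\<forall>x. fps_linear (f x)) \<and> (\<forall>y. fps_linear (\<lambda>x. f x y))"

lemma fps_bilinear_eqI:
  assumes f: "fps_bilinear f" and g: "fps_bilinear g"
    and "\<And>a b. f (fps_const a) (fps_const b) = g (fps_const a) (fps_const b)"
  shows "f x y = g x y"
proof -
  have "f (fps_const a) y = g (fps_const a) y" for a
  proof (rule fps_linear_eqI[of "f (fps_const a)" "g (fps_const a)"])
    show "fps_linear (f (fps_const a))" using f by (simp add: fps_bilinear_def)
    show "fps_linear (g (fps_const a))" using g by (simp add: fps_bilinear_def)
  qed (rule assms(3))
  moreover have "fps_linear (\<lambda>x. f x y)" using f by (simp add: fps_bilinear_def)
  moreover have "fps_linear (\<lambda>x. g x y)" using g by (simp add: fps_bilinear_def)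
  ultimately show ?thesis using fps_linear_eqI[of "\<lambda>x. f x y" "\<lambda>x. g x y"] by blast
qed

lemma fps_bilinear_convolution:
  assumes b: "bilinear \<beta>"
  shows "fps_bilinear (\<lambda>x y. Abs_fps (\<lambda>n. \<Sum>i\<le>n. \<beta> (x $ i) (y $ (n - i))))"
  unfolding fps_bilinear_def
proof (intro conjI allI)
  fix y :: "'b fps"
  have "linear (\<lambda>a. Abs_fps (\<lambda>m. \<beta> a (y $ m)))"
    by (rule linearI) (simp_all add: fps_eq_iff bilinear_ladd[OF b] bilinear_lmul[OF b])
  from fps_linear_extend[OF this]
  show "fps_linear (\<lambda>x. Abs_fps (\<lambda>n. \<Sum>i\<le>n. \<beta> (x $ i) (y $ (n - i))))"
    by (simp add: fps_extend_def[abs_def])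
next
  fix x :: "'a fps"
  have "linear (\<lambda>c. Abs_fps (\<lambda>m. \<beta> (x $ m) c))"
    by (rule linearI) (simp_all add: fps_eq_iff bilinear_radd[OF b] bilinear_rmul[OF b])
  from fps_linear_extend[OF this]
  have "fps_linear (\<lambda>y. Abs_fps (\<lambda>n. \<Sum>i\<le>n. \<beta> (x $ (n - i)) (y $ i)))"
    by (simp add: fps_extend_def[abs_def])
  moreover have "(\<Sum>i\<le>n. \<beta> (x $ (n - i)) (y $ i)) = (\<Sum>i\<le>n. \<beta> (x $ i) (y $ (n - i)))" for y n
    by (rule sum.reindex_bij_witness[of _ "\<lambda>i. n - i" "\<lambda>i. n - i"]) auto
  ultimately show "fps_linear (\<lambda>y. Abs_fps (\<lambda>n. \<Sum>i\<le>n. \<beta> (x $ i) (y $ (n - i))))"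
    by simp
qed

lemma fps_bilinear_mult: "fps_bilinear ((*) :: 'a::real_algebra_1 fps \<Rightarrow> _)"
proof -
  have "(*) = (\<lambda>x y :: 'a fps. Abs_fps (\<lambda>n. \<Sum>i\<le>n. x $ i * y $ (n - i)))"
    by (auto simp: fun_eq_iff fps_eq_iff fps_mult_nth atLeast0AtMost)
  then show ?thesis using fps_bilinear_convolution[OF bilinear_times[where 'a = 'a]] by simp
qed

lemma fps_bilinear_pure_tensor: "fps_bilinear (\<otimes>\<^sub>h)"
  using fps_bilinear_convolution[OF bilinear_pure_tensor]
  by (simp add: fps_pure_tensor_def[abs_def])

lemma fps_bilinear_smult: "fps_bilinear fps_smult"
proof -
  have "bilinear ((*\<^sub>R) :: real \<Rightarrow> 'a \<Rightarrow> 'a)"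
    by (rule bilinearI) (simp_all add: scaleR_add_left scaleR_add_right)
  from fps_bilinear_convolution[OF this] show ?thesis by (simp add: fps_smult_def[abs_def])
qed

lemma fps_bilinear_compose:
  assumes "fps_bilinear f" "fps_linear F" "fps_linear G"
  shows "fps_bilinear (\<lambda>x y. f (F x) (G y))"
  using assms unfolding fps_bilinear_def
  by (auto intro: fps_linear_compose[of "f _"] fps_linear_compose[of "\<lambda>x. f x _"])

lemma fps_bilinear_compose_left:
  assumes "fps_linear F" "fps_bilinear f"
  shows "fps_bilinear (\<lambda>x y. F (f x y))"
  using assms unfolding fps_bilinear_def by (auto intro: fps_linear_compose[of F])

lemma fps_bilinear_swap: "fps_bilinear f \<Longrightarrow> fps_bilinear (\<lambda>x y. f y x)"
  by (auto simp: fps_bilinear_def)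

lemma fps_bilinear_linear_right:
  "fps_bilinear f \<Longrightarrow> fps_linear G \<Longrightarrow> fps_linear (\<lambda>x. f a (G x))"
  unfolding fps_bilinear_def by (auto intro: fps_linear_compose[of "f _"])

lemma fps_bilinear_linear_left:
  "fps_bilinear f \<Longrightarrow> fps_linear G \<Longrightarrow> fps_linear (\<lambda>x. f (G x) a)"
  unfolding fps_bilinear_def by (auto intro: fps_linear_compose[of "\<lambda>x. f x _"])

lemmas fps_bilinear_linear = fps_bilinear_linear_right fps_bilinear_linear_left

lemmas fps_linear_intros =
  fps_linear_ident fps_linear_plus
  fps_bilinear_linear[OF fps_bilinear_mult] fps_bilinear_linear[OF fps_bilinear_pure_tensor]
  fps_bilinear_linear[OF fps_bilinear_smult]

lemma fps_const_pure_tensor: "fps_const a \<otimes>\<^sub>h fps_const b = fps_const (a \<otimes> b)"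
proof (rule fps_ext)
  fix n
  have "(fps_const a \<otimes>\<^sub>h fps_const b) $ n = (\<Sum>i\<le>n. if i = 0 then (if n = 0 then a \<otimes> b else 0) else 0)"
    unfolding fps_pure_tensor_def fps_nth_Abs_fps
    by (intro sum.cong) (auto simp: pure_tensor_simps)
  then show "(fps_const a \<otimes>\<^sub>h fps_const b) $ n = fps_const (a \<otimes> b) $ n" by simp
qed

lemma fps_tensor_eqI:
  assumes F: "fps_linear F" and G: "fps_linear G" and eq: "\<And>x y. F (x \<otimes>\<^sub>h y) = G (x \<otimes>\<^sub>h y)"
  shows "F t = G t"
proof (rule fps_linear_eqI[OF F G])
  fix a
  show "F (fps_const a) = G (fps_const a)"
    by (rule tensor_linear_eqI[OF fps_linear_const[OF F] fps_linear_const[OF G]])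
       (simp add: eq flip: fps_const_pure_tensor)
qed

lemma fps_tensor_lift:
  assumes f: "fps_bilinear f"
  shows "fps_linear (fps_tensor_lift f)" "fps_tensor_lift f (x \<otimes>\<^sub>h y) = f x y"
proof -
  have bil: "bilinear (\<lambda>a b. f (fps_const a) (fps_const b))"
    using f fps_linear_const[of "f (fps_const _)"] fps_linear_const[of "\<lambda>x. f x (fps_const _)"]
    by (auto simp: bilinear_def fps_bilinear_def)
  show lin: "fps_linear (fps_tensor_lift f)"
    unfolding fps_tensor_lift_def by (intro fps_linear_extend linear_tensor_lift bil)
  show "fps_tensor_lift f (x \<otimes>\<^sub>h y) = f x y"
    by (rule fps_bilinear_eqI[OF fps_bilinear_compose_left[OF lin fps_bilinear_pure_tensor] f])
       (simp add: fps_tensor_lift_def fps_const_pure_tensor linear_0[OF linear_tensor_lift[OF bil]] bil)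
qed

lemma fps_pure_tensor_mult:
  "(x \<otimes>\<^sub>h y) * (x' \<otimes>\<^sub>h y') = (x * x') \<otimes>\<^sub>h (y * y')"
  for x x' :: "'a::real_algebra_1 fps" and y y' :: "'b::real_algebra_1 fps"
proof -
  have 1: "(fps_const a \<otimes>\<^sub>h fps_const b) * (x' \<otimes>\<^sub>h y') = (fps_const a * x') \<otimes>\<^sub>h (fps_const b * y')"
    for a :: 'a and b :: 'b
    by (rule fps_bilinear_eqI[of "\<lambda>x' y'. (fps_const a \<otimes>\<^sub>h fps_const b) * (x' \<otimes>\<^sub>h y')"
          "\<lambda>x' y'. (fps_const a * x') \<otimes>\<^sub>h (fps_const b * y')"])
       (auto simp: fps_bilinear_def fps_const_pure_tensor pure_tensor_mult intro!: fps_linear_intros)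
  show ?thesis
    by (rule fps_bilinear_eqI[of "\<lambda>x y. (x \<otimes>\<^sub>h y) * (x' \<otimes>\<^sub>h y')" "\<lambda>x y. (x * x') \<otimes>\<^sub>h (y * y')"])
       (auto simp: fps_bilinear_def 1 intro!: fps_linear_intros)
qed

lemma fps_one_tensor: "(1 :: ('a::real_algebra_1, 'b::real_algebra_1) tensor fps) = 1 \<otimes>\<^sub>h 1"
  unfolding fps_const_1_eq_1[symmetric] fps_const_pure_tensor one_tensor_def ..

subsection \<open>Algebra homomorphisms\<close>

lemma fps_algebra_homD:
  assumes "fps_algebra_hom F"
  shows "fps_linear F" "F 1 = 1" "F (x * y) = F x * F y"
  using assms by (auto simp: fps_algebra_hom_def)

lemma fps_algebra_hom_id: "fps_algebra_hom id"
  by (simp add: fps_algebra_hom_def fps_linear_ident)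

lemma fps_algebra_hom_compose:
  "fps_algebra_hom F \<Longrightarrow> fps_algebra_hom G \<Longrightarrow> fps_algebra_hom (\<lambda>x. F (G x))"
  by (simp add: fps_algebra_hom_def fps_linear_compose)

lemma fps_algebra_hom_tensor:
  assumes F: "fps_linear F" and one: "F (1 \<otimes>\<^sub>h 1) = 1"
    and mult: "\<And>x y x' y'. F ((x * x') \<otimes>\<^sub>h (y * y')) = F (x \<otimes>\<^sub>h y) * F (x' \<otimes>\<^sub>h y')"
  shows "fps_algebra_hom F"
  unfolding fps_algebra_hom_def
proof (intro conjI allI)
  show "F 1 = 1" by (simp add: fps_one_tensor one)
  fix t u
  note mult_lin = fps_bilinear_linear[OF fps_bilinear_mult]
  note lin = fps_linear_compose[OF F mult_lin(1)[OF fps_linear_ident(1)]]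
    fps_linear_compose[OF F mult_lin(2)[OF fps_linear_ident(1)]] mult_lin[OF F]
  have 1: "F ((x \<otimes>\<^sub>h y) * u) = F (x \<otimes>\<^sub>h y) * F u" for x y
  proof (rule fps_tensor_eqI[of "\<lambda>u. F ((x \<otimes>\<^sub>h y) * u)" "\<lambda>u. F (x \<otimes>\<^sub>h y) * F u"])
    show "F ((x \<otimes>\<^sub>h y) * (x' \<otimes>\<^sub>h y')) = F (x \<otimes>\<^sub>h y) * F (x' \<otimes>\<^sub>h y')" for x' y'
      by (simp only: fps_pure_tensor_mult mult)
  qed (rule lin)+
  show "F (t * u) = F t * F u"
    by (rule fps_tensor_eqI[of "\<lambda>t. F (t * u)" "\<lambda>t. F t * F u"]) (rule lin 1)+
qed (rule F)

lemma fps_tensor_map: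
  assumes "fps_linear F" "fps_linear G"
  shows "fps_linear (fps_tensor_map F G)" "fps_tensor_map F G (x \<otimes>\<^sub>h y) = F x \<otimes>\<^sub>h G y"
proof -
  have "fps_bilinear (\<lambda>x y. F x \<otimes>\<^sub>h G y)"
    by (rule fps_bilinear_compose[OF fps_bilinear_pure_tensor assms])
  from fps_tensor_lift[OF this]
  show "fps_linear (fps_tensor_map F G)" "fps_tensor_map F G (x \<otimes>\<^sub>h y) = F x \<otimes>\<^sub>h G y"
    by (simp_all add: fps_tensor_map_def)
qed

lemma fps_algebra_hom_tensor_map:
  assumes "fps_algebra_hom F" "fps_algebra_hom G"
  shows "fps_algebra_hom (fps_tensor_map F G)"
  by (rule fps_algebra_hom_tensor)
     (simp_all add: fps_tensor_map fps_algebra_homD[OF assms(1)] fps_algebra_homD[OF assms(2)]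
       fps_one_tensor fps_pure_tensor_mult)

lemma fps_bilinear_triple_fixed: "fps_bilinear (\<lambda>x y. x \<otimes>\<^sub>h y \<otimes>\<^sub>h z)"
  unfolding fps_bilinear_def by (intro conjI allI fps_linear_intros)

lemma fps_bilinear_triple:
  "fps_bilinear (\<lambda>(t :: ('a::real_vector, 'b::real_vector) tensor fps) (z :: 'c::real_vector fps).
     fps_tensor_lift (\<lambda>x y. x \<otimes>\<^sub>h y \<otimes>\<^sub>h z) t)"
proof -
  note bil = fps_tensor_lift[OF fps_bilinear_triple_fixed]
  have "fps_linear (\<lambda>z :: 'c fps. fps_tensor_lift (\<lambda>x y. x \<otimes>\<^sub>h y \<otimes>\<^sub>h z) t)"
    for t :: "('a, 'b) tensor fps"
  proof (rule fps_linearI)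
    fix z z' :: "'c fps" and s
    show "fps_tensor_lift (\<lambda>x y. x \<otimes>\<^sub>h y \<otimes>\<^sub>h (z + z')) t =
        fps_tensor_lift (\<lambda>x y. x \<otimes>\<^sub>h y \<otimes>\<^sub>h z) t + fps_tensor_lift (\<lambda>x y. x \<otimes>\<^sub>h y \<otimes>\<^sub>h z') t"
    proof (rule fps_tensor_eqI[OF bil(1) fps_linear_plus[OF bil(1) bil(1)]])
      fix x :: "'a fps" and y :: "'b fps"
      have "fps_linear (\<lambda>z :: 'c fps. x \<otimes>\<^sub>h y \<otimes>\<^sub>h z)" by (intro fps_linear_intros)
      from fps_linear_add[OF this]
      show "fps_tensor_lift (\<lambda>x y. x \<otimes>\<^sub>h y \<otimes>\<^sub>h (z + z')) (x \<otimes>\<^sub>h y) =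
          fps_tensor_lift (\<lambda>x y. x \<otimes>\<^sub>h y \<otimes>\<^sub>h z) (x \<otimes>\<^sub>h y)
          + fps_tensor_lift (\<lambda>x y. x \<otimes>\<^sub>h y \<otimes>\<^sub>h z') (x \<otimes>\<^sub>h y)"
        unfolding bil(2) .
    qed
    show "fps_tensor_lift (\<lambda>x y. x \<otimes>\<^sub>h y \<otimes>\<^sub>h fps_smult s z) t =
        fps_smult s (fps_tensor_lift (\<lambda>x y. x \<otimes>\<^sub>h y \<otimes>\<^sub>h z) t)"
    proof (rule fps_tensor_eqI[OF bil(1) fps_bilinear_linear(1)[OF fps_bilinear_smult bil(1)]])
      fix x :: "'a fps" and y :: "'b fps"
      have "fps_linear (\<lambda>z :: 'c fps. x \<otimes>\<^sub>h y \<otimes>\<^sub>h z)" by (intro fps_linear_intros)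
      from fps_linear_smult[OF this]
      show "fps_tensor_lift (\<lambda>x y. x \<otimes>\<^sub>h y \<otimes>\<^sub>h fps_smult s z) (x \<otimes>\<^sub>h y) =
          fps_smult s (fps_tensor_lift (\<lambda>x y. x \<otimes>\<^sub>h y \<otimes>\<^sub>h z) (x \<otimes>\<^sub>h y))"
        unfolding bil(2) .
    qed
  qed
  then show ?thesis by (simp add: fps_bilinear_def bil(1))
qed

lemma fps_assoc:
  "fps_linear fps_assoc" "fps_assoc ((x \<otimes>\<^sub>h y) \<otimes>\<^sub>h z) = x \<otimes>\<^sub>h y \<otimes>\<^sub>h z"
  unfolding fps_assoc_def
  by (simp_all only: fps_tensor_lift[OF fps_bilinear_triple] fps_tensor_lift[OF fps_bilinear_triple_fixed])

lemma fps_algebra_hom_assoc: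
  "fps_algebra_hom (fps_assoc
     :: (('a::real_algebra_1, 'b::real_algebra_1) tensor, 'c::real_algebra_1) tensor fps \<Rightarrow> _)"
    (is "fps_algebra_hom ?F")
proof (rule fps_algebra_hom_tensor)
  note I = fps_linear_ident(1) and T = fps_bilinear_linear[OF fps_bilinear_pure_tensor]
    and M = fps_bilinear_linear[OF fps_bilinear_mult]
  show "?F (1 \<otimes>\<^sub>h 1) = 1" by (simp add: fps_one_tensor fps_assoc)
  fix x x' :: "('a, 'b) tensor fps" and z z' :: "'c fps"
  have 1: "?F (((a \<otimes>\<^sub>h b) * x') \<otimes>\<^sub>h (z * z')) = ?F ((a \<otimes>\<^sub>h b) \<otimes>\<^sub>h z) * ?F (x' \<otimes>\<^sub>h z')"
    for a b
  proof (rule fps_tensor_eqI[of "\<lambda>x'. ?F (((a \<otimes>\<^sub>h b) * x') \<otimes>\<^sub>h (z * z'))"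
        "\<lambda>x'. ?F ((a \<otimes>\<^sub>h b) \<otimes>\<^sub>h z) * ?F (x' \<otimes>\<^sub>h z')"])
    show "fps_linear (\<lambda>x'. ?F (((a \<otimes>\<^sub>h b) * x') \<otimes>\<^sub>h (z * z')))"
      by (rule fps_linear_compose[OF fps_assoc(1) T(2)[OF M(1)[OF I]]])
    show "fps_linear (\<lambda>x'. ?F ((a \<otimes>\<^sub>h b) \<otimes>\<^sub>h z) * ?F (x' \<otimes>\<^sub>h z'))"
      by (rule M(1)[OF fps_linear_compose[OF fps_assoc(1) T(2)[OF I]]])
  qed (simp only: fps_pure_tensor_mult fps_assoc)
  show "?F ((x * x') \<otimes>\<^sub>h (z * z')) = ?F (x \<otimes>\<^sub>h z) * ?F (x' \<otimes>\<^sub>h z')"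
  proof (rule fps_tensor_eqI[of "\<lambda>x. ?F ((x * x') \<otimes>\<^sub>h (z * z'))"
        "\<lambda>x. ?F (x \<otimes>\<^sub>h z) * ?F (x' \<otimes>\<^sub>h z')"])
    show "fps_linear (\<lambda>x. ?F ((x * x') \<otimes>\<^sub>h (z * z')))"
      by (rule fps_linear_compose[OF fps_assoc(1) T(2)[OF M(2)[OF I]]])
    show "fps_linear (\<lambda>x. ?F (x \<otimes>\<^sub>h z) * ?F (x' \<otimes>\<^sub>h z'))"
      by (rule M(2)[OF fps_linear_compose[OF fps_assoc(1) T(2)[OF I]]])
  qed (rule 1)
qed (rule fps_assoc(1))

subsection \<open>The exponential series\<close>

lemma power_nth_below: "a $ 0 = 0 \<Longrightarrow> n < k \<Longrightarrow> (a ^ k) $ n = 0"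
  for a :: "'a::ring_1 fps"
proof (induction k arbitrary: n)
  case (Suc k)
  have "a $ i * (a ^ k) $ (n - i) = 0" if "i \<le> n" for i
    by (cases "i = 0") (use Suc that in auto)
  then show ?case by (simp add: fps_mult_nth)
qed simp

lemma formal_exp_sums:
  fixes a :: "'a::real_algebra_1 fps"
  assumes "a $ 0 = 0"
  shows "(\<lambda>k. (1 / fact k) *\<^sub>R (a ^ k)) sums formal_exp a"
    and formal_exp_nth: "n \<le> N \<Longrightarrow> formal_exp a $ n = (\<Sum>k\<le>N. (1 / fact k) *\<^sub>R (a ^ k)) $ n"
proof -
  let ?t = "\<lambda>k. (1 / fact k) *\<^sub>R (a ^ k)"
  let ?e = "Abs_fps (\<lambda>n. (\<Sum>k\<le>n. ?t k) $ n)"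
  have tail: "(\<Sum>k<N. ?t k) $ n = (\<Sum>k\<le>n. ?t k) $ n" if "n < N" for n N
  proof -
    have "(\<Sum>k<N. ?t k $ n) = (\<Sum>k\<le>n. ?t k $ n)"
      by (rule sum.mono_neutral_right) (use that assms in \<open>auto simp: power_nth_below\<close>)
    then show ?thesis by (simp add: fps_sum_nth)
  qed
  have "?t sums ?e"
    unfolding sums_def tendsto_fps_iff
  proof
    fix n
    show "\<forall>\<^sub>F N in sequentially. (\<Sum>k<N. ?t k) $ n = ?e $ n"
      using eventually_gt_at_top[of n] by eventually_elim (use tail in simp)
  qed
  then have e: "formal_exp a = ?e" by (simp add: formal_exp_def sums_unique[symmetric])
  show "?t sums formal_exp a" unfolding e by fact
  show "n \<le> N \<Longrightarrow> formal_exp a $ n = (\<Sum>k\<le>N. ?t k) $ n"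
    using tail[of n "Suc N"] by (simp add: e lessThan_Suc_atMost)
qed

lemma formal_exp_0 [simp]: "formal_exp 0 = 1"
proof (rule fps_ext)
  fix n
  have "formal_exp (0 :: 'a fps) $ n = (\<Sum>k\<le>n. (1 / fact k) *\<^sub>R (0 ^ k) $ n)"
    using formal_exp_nth[of 0 n n] by (simp add: fps_sum_nth)
  also have "\<dots> = (\<Sum>k\<le>n. if k = 0 then 1 $ n else 0)"
    by (intro sum.cong) (auto simp: power_0_left)
  finally show "formal_exp (0 :: 'a fps) $ n = 1 $ n" by simp
qed

lemma commuting_binomial:
  fixes x y :: "'a::real_algebra_1"
  assumes "x * y = y * x"
  shows "(1 / fact n) *\<^sub>R (x + y) ^ n
    = (\<Sum>i\<le>n. ((1 / fact i) *\<^sub>R x ^ i) * ((1 / fact (n - i)) *\<^sub>R y ^ (n - i)))"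
proof (induction n)
  case (Suc n)
  define S where "S x k = (1 / fact k) *\<^sub>R x ^ k" for x :: 'a and k
  have S_Suc: "x * S x k = real (Suc k) *\<^sub>R S x (Suc k)" for x k
    by (simp add: S_def field_simps del: of_nat_Suc)
  have comm: "S x i * y = y * S x i" for i
    using power_commuting_commutes[OF assms] by (simp add: S_def)
  have IH: "S (x + y) n = (\<Sum>i\<le>n. S x i * S y (n - i))"
    using Suc by (simp add: S_def)
  have "real (Suc n) *\<^sub>R S (x + y) (Suc n) = (x + y) * (\<Sum>i\<le>n. S x i * S y (n - i))"
    by (simp add: S_Suc[symmetric] IH del: of_nat_Suc)
  also have "\<dots> = (\<Sum>i\<le>n. x * S x i * S y (n - i)) + (\<Sum>i\<le>n. S x i * (y * S y (n - i)))"
    by (simp add: distrib_right sum_distrib_left mult.assoc[symmetric] comm sum.distrib)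
  also have "(\<Sum>i\<le>n. x * S x i * S y (n - i))
      = (\<Sum>i\<le>n. real (Suc i) *\<^sub>R (S x (Suc i) * S y (n - i)))"
    by (simp add: S_Suc del: of_nat_Suc)
  also have "\<dots> = (\<Sum>i\<le>Suc n. real i *\<^sub>R (S x i * S y (Suc n - i)))"
    by (subst sum.atMost_Suc_shift) simp
  also have "(\<Sum>i\<le>n. S x i * (y * S y (n - i)))
      = (\<Sum>i\<le>n. real (Suc n - i) *\<^sub>R (S x i * S y (Suc n - i)))"
    by (intro sum.cong refl) (simp add: S_Suc Suc_diff_le del: of_nat_Suc)
  also have "\<dots> = (\<Sum>i\<le>Suc n. real (Suc n - i) *\<^sub>R (S x i * S y (Suc n - i)))"
    by simp
  also have "(\<Sum>i\<le>Suc n. real i *\<^sub>R (S x i * S y (Suc n - i))) + \<dots>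
      = (\<Sum>i\<le>Suc n. real (Suc n) *\<^sub>R (S x i * S y (Suc n - i)))"
    unfolding sum.distrib[symmetric]
    by (intro sum.cong refl) (simp flip: scaleR_add_left of_nat_add)
  finally have "real (Suc n) *\<^sub>R S (x + y) (Suc n)
      = real (Suc n) *\<^sub>R (\<Sum>i\<le>Suc n. S x i * S y (Suc n - i))"
    by (simp only: scaleR_sum_right)
  then have "S (x + y) (Suc n) = (\<Sum>i\<le>Suc n. S x i * S y (Suc n - i))"
    using scaleR_left_imp_eq[of "real (Suc n)"] by (metis of_nat_neq_0)
  then show ?case unfolding S_def .
qed simp

lemma mult_nth_cong:
  fixes x x' y y' :: "'a::semiring_0 fps"
  assumes "\<And>i. i \<le> n \<Longrightarrow> x $ i = x' $ i" "\<And>i. i \<le> n \<Longrightarrow> y $ i = y' $ i"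
  shows "(x * y) $ n = (x' * y') $ n"
  using assms by (simp add: fps_mult_nth)

lemma formal_exp_add:
  fixes a b :: "'a::real_algebra_1 fps"
  assumes ab: "a * b = b * a" and 0: "a $ 0 = 0" "b $ 0 = 0"
  shows "formal_exp (a + b) = formal_exp a * formal_exp b"
proof (rule fps_ext)
  fix n
  define S where "S x k = (1 / fact k) *\<^sub>R x ^ k" for x :: "'a fps" and k
  have low: "(S a i * S b j) $ n = 0" if "n < i + j" for i j
  proof -
    have "(a ^ i * b ^ j) $ n = (\<Sum>k\<le>n. (a ^ i) $ k * (b ^ j) $ (n - k))"
      by (simp add: fps_mult_nth atLeast0AtMost)
    also have "\<dots> = 0"
    proof (rule sum.neutral, rule ballI)
      fix k assume "k \<in> {..n}"
      with that have "k < i \<or> n - k < j" by auto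
      then show "(a ^ i) $ k * (b ^ j) $ (n - k) = 0" using 0 by (auto simp: power_nth_below)
    qed
    finally show ?thesis by (simp add: S_def)
  qed
  have "(formal_exp a * formal_exp b) $ n = ((\<Sum>i\<le>n. S a i) * (\<Sum>j\<le>n. S b j)) $ n"
    unfolding S_def by (intro mult_nth_cong) (simp_all add: formal_exp_nth 0)
  also have "\<dots> = (\<Sum>(i, j)\<in>{..n} \<times> {..n}. (S a i * S b j) $ n)"
    by (simp add: sum_product fps_sum_nth sum.cartesian_product case_prod_unfold)
  also have "\<dots> = (\<Sum>(i, j)\<in>{(i, j). i + j \<le> n}. (S a i * S b j) $ n)"
    by (rule sum.mono_neutral_right) (auto, meson low not_le)
  also have "\<dots> = (\<Sum>k\<le>n. \<Sum>i\<le>k. (S a i * S b (k - i)) $ n)"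
    by (rule sum.triangle_reindex_eq)
  also have "\<dots> = (\<Sum>k\<le>n. S (a + b) k) $ n"
    by (simp add: S_def commuting_binomial[OF ab] fps_sum_nth)
  also have "\<dots> = formal_exp (a + b) $ n"
    unfolding S_def by (simp add: formal_exp_nth[of "a + b" n n] 0)
  finally show "formal_exp (a + b) $ n = (formal_exp a * formal_exp b) $ n" ..
qed

lemma fps_linear_nth_cong:
  assumes "fps_linear F" "\<And>i. i \<le> n \<Longrightarrow> x $ i = y $ i"
  shows "F x $ n = F y $ n"
  unfolding fps_linear_eq_extend[OF assms(1), of x] fps_linear_eq_extend[OF assms(1), of y]
  by (simp add: fps_extend_def assms(2))

lemma fps_linear_formal_exp:
  assumes F: "fps_linear F" and pow: "\<And>k. F (a ^ k) = F a ^ k" and 0: "a $ 0 = 0"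
  shows "F (formal_exp a) = formal_exp (F a)"
proof (rule fps_ext)
  fix n
  have "F a $ 0 = F 0 $ 0" by (rule fps_linear_nth_cong[OF F]) (simp add: 0)
  then have Fa0: "F a $ 0 = 0" by (simp add: fps_linear_0[OF F])
  have "F (formal_exp a) $ n = F (\<Sum>k\<le>n. (1 / fact k) *\<^sub>R (a ^ k)) $ n"
    by (rule fps_linear_nth_cong[OF F]) (simp add: formal_exp_nth 0)
  then show "F (formal_exp a) $ n = formal_exp (F a) $ n"
    by (simp add: formal_exp_nth[OF Fa0, of n n] fps_linear_sum[OF F] fps_linear_scaleR[OF F] pow)
qed

lemma fps_algebra_hom_formal_exp:
  assumes F: "fps_algebra_hom F" and 0: "a $ 0 = 0"
  shows "F (formal_exp a) = formal_exp (F a)"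
proof (rule fps_linear_formal_exp[OF fps_algebra_homD(1)[OF F] _ 0])
  show "F (a ^ k) = F a ^ k" for k
    by (induction k) (simp_all add: fps_algebra_homD[OF F])
qed

subsection \<open>The enveloping algebra\<close>

lemma linear_abs_schroedinger: "linear abs_schroedinger"
  by (rule linearI) (simp_all add: plus_schroedinger.abs_eq scaleR_schroedinger.abs_eq)

lemma schroedinger_word_induct:
  assumes word: "\<And>w. P (abs_schroedinger (Poly_Mapping.single w 1))"
    and add: "\<And>x y. P x \<Longrightarrow> P y \<Longrightarrow> P (x + y)" and scale: "\<And>r x. P x \<Longrightarrow> P (r *\<^sub>R x)"
  shows "P x"
proof -
  obtain p where x: "x = abs_schroedinger p"
    using Quotient3_abs_rep[OF Quotient3_schroedinger] by metis
  have z: "P 0" using scale[OF word, of 0 "[]"] by simp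
  have sum: "P (\<Sum>w\<in>A. c w *\<^sub>R abs_schroedinger (Poly_Mapping.single w 1))" if "finite A" for c A
    using that by induction (auto intro: z word add scale)
  have "x = abs_schroedinger (lin_ext (\<lambda>k. Poly_Mapping.single k 1) p)"
    by (simp add: x lin_ext_single_id)
  also have "\<dots> = (\<Sum>w\<in>Poly_Mapping.keys p.
      Poly_Mapping.lookup p w *\<^sub>R abs_schroedinger (Poly_Mapping.single w 1))"
    unfolding lin_ext_def
    by (simp add: linear_sum[OF linear_abs_schroedinger] linear_scale[OF linear_abs_schroedinger])
  finally show ?thesis using sum[OF finite_keys] by simp
qed

lemma abs_single_Cons:
  "abs_schroedinger (Poly_Mapping.single (g # w) 1)
   = schroedinger_of_gen g * abs_schroedinger (Poly_Mapping.single w 1)"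
  by (simp add: schroedinger_of_gen.abs_eq times_schroedinger.abs_eq mult_single plus_list_def)

lemma abs_single_snoc:
  "abs_schroedinger (Poly_Mapping.single (w @ [g]) 1)
   = abs_schroedinger (Poly_Mapping.single w 1) * schroedinger_of_gen g"
  by (simp add: schroedinger_of_gen.abs_eq times_schroedinger.abs_eq mult_single plus_list_def)

lemma abs_single_Nil: "abs_schroedinger (Poly_Mapping.single [] 1) = 1"
  using single_one[where 'a = "schroedinger_gen list" and 'b = real]
  by (simp add: one_schroedinger.abs_eq zero_list_def)

lemma schroedinger_induct:
  assumes "P 1" "\<And>g x. P x \<Longrightarrow> P (schroedinger_of_gen g * x)"
    and "\<And>x y. P x \<Longrightarrow> P y \<Longrightarrow> P (x + y)" "\<And>r x. P x \<Longrightarrow> P (r *\<^sub>R x)"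
  shows "P x"
proof (rule schroedinger_word_induct)
  show "P (abs_schroedinger (Poly_Mapping.single w 1))" for w
    by (induction w) (simp_all add: abs_single_Nil abs_single_Cons assms)
qed (fact assms)+

lemma schroedinger_induct_right:
  assumes "P 1" "\<And>g x. P x \<Longrightarrow> P (x * schroedinger_of_gen g)"
    and "\<And>x y. P x \<Longrightarrow> P y \<Longrightarrow> P (x + y)" "\<And>r x. P x \<Longrightarrow> P (r *\<^sub>R x)"
  shows "P x"
proof (rule schroedinger_word_induct)
  show "P (abs_schroedinger (Poly_Mapping.single w 1))" for w
    by (induction w rule: rev_induct) (simp_all add: abs_single_Nil abs_single_snoc assms)
qed (fact assms)+

lemma schroedinger_relator_zero: "r \<in> schroedinger_relators \<Longrightarrow> abs_schroedinger r = 0"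
  unfolding zero_schroedinger_def
proof -
  assume "r \<in> schroedinger_relators"
  then have "1 * r * 1 \<in> schroedinger_ideal"
    unfolding schroedinger_ideal_def by (intro span_base) blast
  then have "schroedinger_eq r 0" by (simp add: schroedinger_eq_def)
  then show "abs_schroedinger r = abs_schroedinger 0" by (simp add: schroedinger.abs_eq_iff)
qed

lemma schroedinger_commutation:
  "commutator (gen Dg) (gen Pg) = - gen Pg"
  "commutator (gen Dg) (gen Kg) = gen Kg"
  "commutator (gen Kg) (gen Pg) = gen Mg"
  "commutator (gen Dg) (gen Hg) = - (2 * gen Hg)"
  "commutator (gen Dg) (gen Cg) = 2 * gen Cg"
  "commutator (gen Hg) (gen Cg) = gen Dg"
  "commutator (gen Kg) (gen Hg) = gen Pg"
  "commutator (gen Kg) (gen Cg) = 0"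
  "commutator (gen Pg) (gen Cg) = - gen Kg"
  "commutator (gen Pg) (gen Hg) = 0"
  "commutator (gen Mg) (gen g) = 0"
proof -
  have eq: "abs_schroedinger p = abs_schroedinger q" if "p - q \<in> schroedinger_relators" for p q
    using schroedinger_relator_zero[OF that] by (simp flip: minus_schroedinger.abs_eq)
  have comm: "commutator (gen g) (gen h)
      = fps_const (abs_schroedinger (commutator (free_gen g) (free_gen h)))" for g h
    by (simp add: gen_def commutator_def schroedinger_of_gen.abs_eq fps_const_mult
        times_schroedinger.abs_eq minus_schroedinger.abs_eq)
  have g: "gen g = fps_const (abs_schroedinger (free_gen g))"
    "- gen g = fps_const (abs_schroedinger (- free_gen g))"
    "2 * gen g = fps_const (abs_schroedinger (2 * free_gen g))"
    "- (2 * gen g) = fps_const (abs_schroedinger (- (2 * free_gen g)))" for g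
    by (simp_all add: gen_def schroedinger_of_gen.abs_eq mult_2
        flip: plus_schroedinger.abs_eq uminus_schroedinger.abs_eq minus_schroedinger.abs_eq fps_const_add fps_const_neg)
  have z: "0 = fps_const (abs_schroedinger 0)" by (simp add: zero_schroedinger.abs_eq)
  note rel = schroedinger_relators_def Let_def
  show "commutator (gen Dg) (gen Pg) = - gen Pg"
    unfolding comm unfolding g(2) by (intro arg_cong[of _ _ fps_const] eq) (unfold rel, blast)
  show "commutator (gen Dg) (gen Kg) = gen Kg"
    unfolding comm unfolding g(1)[of Kg] by (intro arg_cong[of _ _ fps_const] eq) (unfold rel, blast)
  show "commutator (gen Kg) (gen Pg) = gen Mg"
    unfolding comm unfolding g(1)[of Mg] by (intro arg_cong[of _ _ fps_const] eq) (unfold rel, blast)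
  show "commutator (gen Dg) (gen Hg) = - (2 * gen Hg)"
    unfolding comm unfolding g(4) by (intro arg_cong[of _ _ fps_const] eq) (unfold rel, blast)
  show "commutator (gen Dg) (gen Cg) = 2 * gen Cg"
    unfolding comm unfolding g(3) by (intro arg_cong[of _ _ fps_const] eq) (unfold rel, blast)
  show "commutator (gen Hg) (gen Cg) = gen Dg"
    unfolding comm unfolding g(1)[of Dg] by (intro arg_cong[of _ _ fps_const] eq) (unfold rel, blast)
  show "commutator (gen Kg) (gen Hg) = gen Pg"
    unfolding comm unfolding g(1)[of Pg] by (intro arg_cong[of _ _ fps_const] eq) (unfold rel, blast)
  show "commutator (gen Kg) (gen Cg) = 0"
    unfolding comm unfolding z by (intro arg_cong[of _ _ fps_const] eq) (unfold rel, blast)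
  show "commutator (gen Pg) (gen Cg) = - gen Kg"
    unfolding comm unfolding g(2) by (intro arg_cong[of _ _ fps_const] eq) (unfold rel, blast)
  show "commutator (gen Pg) (gen Hg) = 0"
    unfolding comm unfolding z by (intro arg_cong[of _ _ fps_const] eq) (unfold rel, blast)
  show "commutator (gen Mg) (gen g) = 0"
    unfolding comm unfolding z by (intro arg_cong[of _ _ fps_const] eq) (unfold rel, blast)
qed

lemma fps_linear_imp_linear: "fps_linear F \<Longrightarrow> linear F"
  by (rule linearI) (simp_all add: fps_linear_add fps_linear_scaleR)

lemma schroedinger_lift:
  fixes m :: "'b::real_vector fps \<Rightarrow> 'b fps \<Rightarrow> 'b fps" and e :: "'b fps"
    and v :: "schroedinger_gen \<Rightarrow> 'b fps"
  assumes m: "fps_bilinear m"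
    and assoc: "\<And>x y z. m (m x y) z = m x (m y z)" and unit: "\<And>x. m e x = x" "\<And>x. m x e = x"
    and rels:
      "m (v Dg) (v Pg) - m (v Pg) (v Dg) = - v Pg"
      "m (v Dg) (v Kg) - m (v Kg) (v Dg) = v Kg"
      "m (v Kg) (v Pg) - m (v Pg) (v Kg) = v Mg"
      "m (v Dg) (v Hg) - m (v Hg) (v Dg) = - (v Hg + v Hg)"
      "m (v Dg) (v Cg) - m (v Cg) (v Dg) = v Cg + v Cg"
      "m (v Hg) (v Cg) - m (v Cg) (v Hg) = v Dg"
      "m (v Kg) (v Hg) - m (v Hg) (v Kg) = v Pg"
      "m (v Kg) (v Cg) - m (v Cg) (v Kg) = 0"
      "m (v Pg) (v Cg) - m (v Cg) (v Pg) = - v Kg"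
      "m (v Pg) (v Hg) - m (v Hg) (v Pg) = 0"
      "\<And>g. m (v Mg) (v g) - m (v g) (v Mg) = 0"
  obtains F where "fps_linear F" "F 1 = e" "\<And>x y. F (x * y) = m (F x) (F y)" "\<And>g. F (gen g) = v g"
proof -
  define u where "u w = foldr (\<lambda>g. m (v g)) w e" for w
  define \<psi> where "\<psi> = lin_ext u"
  have lin: "linear \<psi>" unfolding \<psi>_def by (rule linear_lin_ext)
  have single: "\<psi> (Poly_Mapping.single w 1) = u w" for w by (simp add: \<psi>_def)
  have u_append: "u (w @ w') = m (u w) (u w')" for w w'
    by (induction w) (simp_all add: u_def unit assoc)
  have mr: "linear (m x)" and ml: "linear (\<lambda>x. m x y)" for x y
    using m by (auto intro: fps_linear_imp_linear simp: fps_bilinear_def)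
  note mr = mr[THEN linear_sum] mr[THEN linear_scale] mr[THEN linear_diff] mr[THEN linear_0]
    and ml = ml[THEN linear_sum] ml[THEN linear_scale] ml[THEN linear_diff] ml[THEN linear_0]
  have \<psi>_mult: "\<psi> (p * q) = m (\<psi> p) (\<psi> q)" for p q
  proof -
    have "\<psi> (lin_ext (\<lambda>k. Poly_Mapping.single k 1) p * lin_ext (\<lambda>k. Poly_Mapping.single k 1) q)
        = (\<Sum>k\<in>Poly_Mapping.keys p. \<Sum>l\<in>Poly_Mapping.keys q.
            (Poly_Mapping.lookup p k * Poly_Mapping.lookup q l) *\<^sub>R u (k @ l))"
      unfolding lin_ext_def sum_product scaleR_single mult_single linear_sum[OF lin]
      by (simp add: plus_list_def \<psi>_def)
    also have "\<dots> = (\<Sum>l\<in>Poly_Mapping.keys q. \<Sum>k\<in>Poly_Mapping.keys p.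
            (Poly_Mapping.lookup p k * Poly_Mapping.lookup q l) *\<^sub>R u (k @ l))"
      by (rule sum.swap)
    also have "\<dots> = m (\<psi> p) (\<psi> q)"
      unfolding \<psi>_def lin_ext_def ml(1) mr(1) ml(2) mr(2) u_append
      by (simp add: scaleR_sum_right mult.commute)
    finally show ?thesis by (simp only: lin_ext_single_id)
  qed
  have free: "\<psi> (free_gen g) = v g" for g by (simp add: single u_def unit)
  have "\<psi> r = 0" if "r \<in> schroedinger_relators" for r
    using that unfolding schroedinger_relators_def Let_def commutator_def mult_2
    by (auto simp: linear_diff[OF lin] linear_add[OF lin] linear_neg[OF lin] linear_0[OF lin]
        \<psi>_mult free rels)
  then have "\<psi> (p * r * q) = 0" if "r \<in> schroedinger_relators" for p r q
    using that by (simp add: \<psi>_mult mr(4) ml(4))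
  then have ideal: "\<psi> x = 0" if "x \<in> schroedinger_ideal" for x
    using linear_eq_0_on_span[OF lin _ that[unfolded schroedinger_ideal_def]] by blast
  define \<phi> where "\<phi> = (\<lambda>x. \<psi> (rep_schroedinger x))"
  have \<phi>_abs: "\<phi> (abs_schroedinger p) = \<psi> p" for p
  proof -
    have "schroedinger_eq (rep_schroedinger (abs_schroedinger p)) p"
      by (rule Quotient3_rep_abs[OF Quotient3_schroedinger]) (rule equivp_reflp[OF schroedinger_equivp])
    then show ?thesis
      using ideal[of "rep_schroedinger (abs_schroedinger p) - p"]
      by (simp add: \<phi>_def schroedinger_eq_def linear_diff[OF lin])
  qed
  have ex: "\<exists>p. x = abs_schroedinger p" for x
    using Quotient3_abs_rep[OF Quotient3_schroedinger] by metis
  have \<phi>_lin: "linear \<phi>"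
  proof (rule linearI)
    fix x y :: schroedinger and r :: real
    obtain p q where "x = abs_schroedinger p" "y = abs_schroedinger q" using ex by blast
    then show "\<phi> (x + y) = \<phi> x + \<phi> y" "\<phi> (r *\<^sub>R x) = r *\<^sub>R \<phi> x"
      by (simp_all add: plus_schroedinger.abs_eq scaleR_schroedinger.abs_eq \<phi>_abs
          linear_add[OF lin] linear_scale[OF lin])
  qed
  have \<phi>_mult: "\<phi> (x * y) = m (\<phi> x) (\<phi> y)" for x y
  proof -
    obtain p q where "x = abs_schroedinger p" "y = abs_schroedinger q" using ex by blast
    then show ?thesis by (simp add: times_schroedinger.abs_eq \<phi>_abs \<psi>_mult)
  qed
  have \<phi>_1: "\<phi> 1 = e"
    unfolding abs_single_Nil[symmetric] \<phi>_abs single by (simp add: u_def)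
  let ?F = "fps_extend \<phi>"
  note const = fps_extend_const[of \<phi>, OF linear_0[OF \<phi>_lin]]
  have F_lin: "fps_linear ?F" by (rule fps_linear_extend[OF \<phi>_lin])
  show ?thesis
  proof
    show "fps_linear ?F" by fact
    show "?F 1 = e" using const[of 1] by (simp add: \<phi>_1)
    show "?F (gen g) = v g" for g by (simp add: gen_def const schroedinger_of_gen.abs_eq \<phi>_abs free)
    show "?F (x * y) = m (?F x) (?F y)" for x y
      by (rule fps_bilinear_eqI[OF fps_bilinear_compose_left[OF F_lin fps_bilinear_mult]
            fps_bilinear_compose[OF m F_lin F_lin]])
         (simp add: fps_const_mult const \<phi>_mult)
  qed
qed

lemma schroedinger_hom_eqI:
  assumes F: "fps_algebra_hom F" and G: "fps_algebra_hom G" and eq: "\<And>g. F (gen g) = G (gen g)"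
  shows "F x = G x"
proof (rule fps_linear_eqI[OF fps_algebra_homD(1)[OF F] fps_algebra_homD(1)[OF G]])
  note lF = fps_linear_const[OF fps_algebra_homD(1)[OF F]]
    and lG = fps_linear_const[OF fps_algebra_homD(1)[OF G]]
  fix a
  show "F (fps_const a) = G (fps_const a)"
  proof (induction a rule: schroedinger_induct)
    case 1
    show ?case by (simp add: fps_algebra_homD(2)[OF F] fps_algebra_homD(2)[OF G])
  next
    case (2 g x)
    then show ?case
      using eq[of g] fps_algebra_homD(3)[OF F, of "gen g" "fps_const x"]
        fps_algebra_homD(3)[OF G, of "gen g" "fps_const x"]
      by (simp add: gen_def)
  next
    case (3 x y)
    then show ?case by (simp add: linear_add[OF lF] linear_add[OF lG] del: fps_const_add)
  next
    case (4 r x)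
    then show ?case by (simp add: linear_scale[OF lF] linear_scale[OF lG])
  qed
qed

subsection \<open>Coproduct, counit and antipode\<close>

lemma formal_exp_commute:
  fixes a b :: "'a::real_algebra_1 fps"
  assumes ab: "b * a = a * b" and 0: "a $ 0 = 0"
  shows "b * formal_exp a = formal_exp a * b"
proof (rule fps_ext)
  fix n
  let ?T = "\<Sum>k\<le>n. (1 / fact k) *\<^sub>R (a ^ k)"
  have "b * a ^ k = a ^ k * b" for k
    by (rule power_commuting_commutes[OF ab[symmetric], symmetric])
  then have "b * ?T = ?T * b" by (simp add: sum_distrib_left sum_distrib_right)
  moreover have "(b * formal_exp a) $ n = (b * ?T) $ n" "(formal_exp a * b) $ n = (?T * b) $ n"
    by (intro mult_nth_cong; simp add: formal_exp_nth 0)+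
  ultimately show "(b * formal_exp a) $ n = (formal_exp a * b) $ n" by simp
qed

lemma fps_smult_X: "fps_smult fps_X x = fps_X * x" for x :: "'a::real_algebra_1 fps"
  using fps_smult_X_power_nth[of 1 x] by (simp add: fps_eq_iff)

definition grouplike :: "real \<Rightarrow> schroedinger fps" where
  "grouplike r = formal_exp (r *\<^sub>R (c1 * gen Mg))"

definition gen_weight :: "schroedinger_gen \<Rightarrow> real" where
  "gen_weight g = (case g of Dg \<Rightarrow> 0 | Hg \<Rightarrow> 2 | Pg \<Rightarrow> 1 | Kg \<Rightarrow> -1 | Cg \<Rightarrow> -2 | Mg \<Rightarrow> 0)"

lemma gen_weight_simps [simp]:
  "gen_weight Dg = 0" "gen_weight Hg = 2" "gen_weight Pg = 1"
  "gen_weight Kg = -1" "gen_weight Cg = -2" "gen_weight Mg = 0"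
  by (simp_all add: gen_weight_def)

lemma grouplike_add: "grouplike (r + s) = grouplike r * grouplike s"
  unfolding grouplike_def scaleR_add_left by (rule formal_exp_add) (simp_all add: mult_ac)

lemma grouplike_0 [simp]: "grouplike 0 = 1"
  by (simp add: grouplike_def)

lemma grouplike_inverse: "grouplike r * grouplike (- r) = 1" "grouplike (- r) * grouplike r = 1"
  by (simp_all flip: grouplike_add)

lemma grouplike_commute: "grouplike r * grouplike s = grouplike s * grouplike r"
  by (simp add: add.commute flip: grouplike_add)

lemma gen_grouplike: "gen g * grouplike r = grouplike r * gen g"
  unfolding grouplike_def
proof (rule formal_exp_commute)
  have "gen Mg * gen g = gen g * gen Mg"
    using schroedinger_commutation(11)[of g] by (simp add: commutator_def)
  then show "gen g * r *\<^sub>R (c1 * gen Mg) = r *\<^sub>R (c1 * gen Mg) * gen g"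
    by simp (metis mult.assoc fps_mult_fps_X_commute)
qed simp

lemma hom_grouplike:
  assumes F: "fps_algebra_hom F"
  shows "F (grouplike r) = formal_exp (r *\<^sub>R (fps_X * F (gen Mg)))"
proof -
  note lin = fps_algebra_homD(1)[OF F]
  have "F (grouplike r) = formal_exp (F (r *\<^sub>R (c1 * gen Mg)))"
    unfolding grouplike_def by (rule fps_algebra_hom_formal_exp[OF F]) simp
  then show ?thesis
    by (simp only: fps_linear_scaleR[OF lin] fps_linear_smult[OF lin] fps_smult_X[symmetric])
qed

lemma fps_pure_tensor_linear:
  "fps_linear (\<lambda>y. x \<otimes>\<^sub>h y)" "fps_linear (\<lambda>x. x \<otimes>\<^sub>h y)"
  using fps_bilinear_pure_tensor by (auto simp: fps_bilinear_def)

lemmas fps_pure_tensor_simps =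
  fps_pure_tensor_linear[THEN fps_linear_add] fps_pure_tensor_linear[THEN fps_linear_minus]
  fps_pure_tensor_linear[THEN fps_linear_diff] fps_pure_tensor_linear[THEN fps_linear_0]
  fps_pure_tensor_linear[THEN fps_linear_scaleR] fps_pure_tensor_linear[THEN fps_linear_smult]

lemma schroedinger_coproduct_exists:
  obtains \<Delta> where "fps_algebra_hom \<Delta>"
    "\<And>g. \<Delta> (gen g) = 1 \<otimes>\<^sub>h gen g + gen g \<otimes>\<^sub>h grouplike (gen_weight g)"
proof -
  define v where "v g = 1 \<otimes>\<^sub>h gen g + gen g \<otimes>\<^sub>h grouplike (gen_weight g)" for g
  have comm: "v g * v h - v h * v g = 1 \<otimes>\<^sub>h commutator (gen g) (gen h)
      + commutator (gen g) (gen h) \<otimes>\<^sub>h grouplike (gen_weight g + gen_weight h)" for g h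
    unfolding v_def commutator_def grouplike_add
    by (simp add: distrib_left distrib_right fps_pure_tensor_mult fps_pure_tensor_simps
        gen_grouplike grouplike_commute[of "gen_weight h"])
  note rels = comm schroedinger_commutation mult_2 fps_pure_tensor_simps v_def
  show ?thesis
  proof (rule schroedinger_lift[OF fps_bilinear_mult, of 1 v])
    fix F assume "fps_linear F" "F 1 = 1" "\<And>x y. F (x * y) = F x * F y" "\<And>g. F (gen g) = v g"
    then show thesis by (intro that[of F]) (simp_all add: fps_algebra_hom_def v_def)
  qed (simp_all only: mult.assoc mult_1_left mult_1_right comm, simp_all add: rels)
qed

lemma schroedinger_counit_exists:
  obtains \<epsilon> :: "schroedinger fps \<Rightarrow> real fps" where "fps_algebra_hom \<epsilon>" "\<And>g. \<epsilon> (gen g) = 0"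
proof -
  show ?thesis
  proof (rule schroedinger_lift[OF fps_bilinear_mult, of "1 :: real fps" "\<lambda>_. 0"])
    fix F :: "schroedinger fps \<Rightarrow> real fps"
    assume "fps_linear F" "F 1 = 1" "\<And>x y. F (x * y) = F x * F y" "\<And>g. F (gen g) = 0"
    then show thesis by (intro that[of F]) (simp_all add: fps_algebra_hom_def)
  qed simp_all
qed

lemma schroedinger_antipode_exists:
  obtains S :: "schroedinger fps \<Rightarrow> schroedinger fps"
    where "fps_linear S" "S 1 = 1" "\<And>x y. S (x * y) = S y * S x"
      "\<And>g. S (gen g) = - (gen g * grouplike (- gen_weight g))"
proof -
  define v where "v g = - (gen g * grouplike (- gen_weight g))" for g
  have comm: "v h * v g - v g * v h
      = - (commutator (gen g) (gen h) * grouplike (- (gen_weight g + gen_weight h)))" for g h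
  proof -
    have "v h * v g = gen h * gen g * grouplike (- (gen_weight g + gen_weight h))" for g h
    proof -
      have "v h * v g = gen h * (grouplike (- gen_weight h) * gen g) * grouplike (- gen_weight g)"
        by (simp add: v_def mult.assoc)
      also have "\<dots> = gen h * gen g * (grouplike (- gen_weight h) * grouplike (- gen_weight g))"
        by (simp add: gen_grouplike mult.assoc flip: gen_grouplike)
      finally show ?thesis by (simp add: add.commute flip: grouplike_add)
    qed
    from this[of h g] this[of g h] show ?thesis
      by (simp add: commutator_def algebra_simps)
  qed
  show ?thesis
  proof (rule schroedinger_lift[OF fps_bilinear_swap[OF fps_bilinear_mult], of 1 v])
    fix S assume "fps_linear S" "S 1 = 1" "\<And>x y. S (x * y) = S y * S x" "\<And>g. S (gen g) = v g"
    then show thesis by (intro that[of S]) (simp_all add: v_def)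
  qed (simp_all only: mult.assoc mult_1_left mult_1_right comm,
      simp_all add: schroedinger_commutation mult_2 v_def distrib_right left_diff_distrib)
qed

lemma counit_tensor_hom:
  fixes \<epsilon> :: "'a::real_algebra_1 fps \<Rightarrow> real fps"
  assumes \<epsilon>: "fps_algebra_hom \<epsilon>"
  shows "fps_algebra_hom (fps_tensor_lift (\<lambda>y z :: 'a fps. fps_smult (\<epsilon> y) z))" (is "fps_algebra_hom ?L")
    and "fps_algebra_hom (fps_tensor_lift (\<lambda>y :: 'a fps. \<lambda>z. fps_smult (\<epsilon> z) y))" (is "fps_algebra_hom ?R")
    and "fps_tensor_lift (\<lambda>y z :: 'a fps. fps_smult (\<epsilon> y) z) (x \<otimes>\<^sub>h x') = fps_smult (\<epsilon> x) x'"
    and "fps_tensor_lift (\<lambda>y :: 'a fps. \<lambda>z. fps_smult (\<epsilon> z) y) (x \<otimes>\<^sub>h x') = fps_smult (\<epsilon> x') x"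
proof -
  have l: "fps_bilinear (\<lambda>y z :: 'a fps. fps_smult (\<epsilon> y) z)"
    by (rule fps_bilinear_compose[OF fps_bilinear_smult fps_algebra_homD(1)[OF \<epsilon>] fps_linear_ident(1)])
  have r: "fps_bilinear (\<lambda>y :: 'a fps. \<lambda>z. fps_smult (\<epsilon> z) y)"
    by (rule fps_bilinear_swap[OF l])
  have sm: "fps_smult (s * s') (y * y') = fps_smult s y * fps_smult s' y'" for s s' and y y' :: "'a fps"
  proof -
    have M: "fps_linear (\<lambda>y. y * b)" "fps_linear (\<lambda>y. b * y)" for b :: "'a fps"
      using fps_bilinear_mult by (auto simp: fps_bilinear_def)
    show ?thesis
      using fps_linear_smult[OF M(1)] fps_linear_smult[OF M(2)] by (metis fps_module.scale_scale)
  qed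
  note L = fps_tensor_lift[OF l] and R = fps_tensor_lift[OF r]
  show "?L (x \<otimes>\<^sub>h x') = fps_smult (\<epsilon> x) x'" "?R (x \<otimes>\<^sub>h x') = fps_smult (\<epsilon> x') x"
    by (rule L R)+
  show "fps_algebra_hom ?L"
    by (rule fps_algebra_hom_tensor[OF L(1)]) (simp_all only: L(2) fps_algebra_homD[OF \<epsilon>] sm, simp)
  show "fps_algebra_hom ?R"
    by (rule fps_algebra_hom_tensor[OF R(1)]) (simp_all only: R(2) fps_algebra_homD[OF \<epsilon>] sm, simp)
qed

theorem ex_schroedinger_hopf_algebra:
  "\<exists>\<Delta> \<epsilon> S. topological_hopf_algebra \<Delta> \<epsilon> S
    \<and> \<Delta> (gen Dg) = 1 \<otimes>\<^sub>h gen Dg + gen Dg \<otimes>\<^sub>h 1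
    \<and> \<Delta> (gen Mg) = 1 \<otimes>\<^sub>h gen Mg + gen Mg \<otimes>\<^sub>h 1
    \<and> \<Delta> (gen Pg) = 1 \<otimes>\<^sub>h gen Pg + gen Pg \<otimes>\<^sub>h formal_exp (c1 * gen Mg)
    \<and> \<Delta> (gen Kg) = 1 \<otimes>\<^sub>h gen Kg + gen Kg \<otimes>\<^sub>h formal_exp (- (c1 * gen Mg))
    \<and> \<Delta> (gen Hg) = 1 \<otimes>\<^sub>h gen Hg + gen Hg \<otimes>\<^sub>h formal_exp (2 * c1 * gen Mg)
    \<and> \<Delta> (gen Cg) = 1 \<otimes>\<^sub>h gen Cg + gen Cg \<otimes>\<^sub>h formal_exp (- (2 * c1 * gen Mg))"
proof -
  obtain \<Delta> where \<Delta>: "fps_algebra_hom \<Delta>"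
    and \<Delta>_gen: "\<And>g. \<Delta> (gen g) = 1 \<otimes>\<^sub>h gen g + gen g \<otimes>\<^sub>h grouplike (gen_weight g)"
    using schroedinger_coproduct_exists by blast
  obtain \<epsilon> :: "schroedinger fps \<Rightarrow> real fps"
    where \<epsilon>: "fps_algebra_hom \<epsilon>" and \<epsilon>_gen: "\<And>g. \<epsilon> (gen g) = 0"
    using schroedinger_counit_exists by blast
  obtain S where S: "fps_linear S" "S 1 = 1" "\<And>x y. S (x * y) = S y * S x"
    and S_gen: "\<And>g. S (gen g) = - (gen g * grouplike (- gen_weight g))"
    using schroedinger_antipode_exists by blast
  note \<Delta>D = fps_algebra_homD[OF \<Delta>] and \<epsilon>D = fps_algebra_homD[OF \<epsilon>]
  have \<Delta>_grouplike: "\<Delta> (grouplike r) = grouplike r \<otimes>\<^sub>h grouplike r" for r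
  proof -
    let ?z = "r *\<^sub>R (c1 * gen Mg)"
    have L: "fps_algebra_hom (\<lambda>a :: schroedinger fps. (1 :: schroedinger fps) \<otimes>\<^sub>h a)"
      and R: "fps_algebra_hom (\<lambda>a :: schroedinger fps. a \<otimes>\<^sub>h (1 :: schroedinger fps))"
      by (simp_all add: fps_algebra_hom_def fps_pure_tensor_linear fps_one_tensor fps_pure_tensor_mult)
    have "\<Delta> (grouplike r) = formal_exp (1 \<otimes>\<^sub>h ?z + ?z \<otimes>\<^sub>h 1)"
      unfolding hom_grouplike[OF \<Delta>] \<Delta>_gen fps_smult_X[symmetric]
      by (simp add: fps_pure_tensor_simps fps_module.scale_right_distrib scaleR_add_right)
    also have "\<dots> = formal_exp (1 \<otimes>\<^sub>h ?z) * formal_exp (?z \<otimes>\<^sub>h 1)"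
    proof (rule formal_exp_add)
      show "(1 \<otimes>\<^sub>h ?z) * (?z \<otimes>\<^sub>h 1) = (?z \<otimes>\<^sub>h 1) * (1 \<otimes>\<^sub>h ?z)"
        by (simp add: fps_pure_tensor_mult)
    qed (simp_all add: fps_pure_tensor_def pure_tensor_simps)
    also have "\<dots> = (1 \<otimes>\<^sub>h grouplike r) * (grouplike r \<otimes>\<^sub>h 1)"
      using fps_algebra_hom_formal_exp[OF L, of ?z] fps_algebra_hom_formal_exp[OF R, of ?z]
      by (simp add: grouplike_def)
    finally show ?thesis by (simp add: fps_pure_tensor_mult)
  qed
  have \<epsilon>_grouplike: "\<epsilon> (grouplike r) = 1" for r
    by (simp add: hom_grouplike[OF \<epsilon>] \<epsilon>_gen)
  have S_grouplike: "S (grouplike r) = grouplike (- r)" for r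
  proof -
    let ?z = "r *\<^sub>R (c1 * gen Mg)"
    have "S (?z ^ k) = S ?z ^ k" for k
      by (induction k) (simp_all only: power_0 power_Suc2 S(2,3) power_Suc power_commutes)
    then have "S (grouplike r) = formal_exp (S ?z)"
      unfolding grouplike_def by (intro fps_linear_formal_exp[OF S(1)]) simp_all
    also have "S ?z = (- r) *\<^sub>R (c1 * gen Mg)"
      unfolding fps_smult_X[symmetric] fps_linear_scaleR[OF S(1)] fps_linear_smult[OF S(1)] S_gen
      by simp
    finally show ?thesis by (simp add: grouplike_def)
  qed
  have "topological_hopf_algebra \<Delta> \<epsilon> S"
  proof (rule topological_hopf_algebra.intro)
    show "fps_algebra_hom \<Delta>" "fps_algebra_hom \<epsilon>" "fps_linear S" by fact+
    fix x
    let ?\<Delta>1 = "fps_tensor_map \<Delta> id" and ?\<Delta>2 = "fps_tensor_map id \<Delta>"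
    note map1 = fps_tensor_map[OF \<Delta>D(1) fps_linear_ident(2)]
      and map2 = fps_tensor_map[OF fps_linear_ident(2) \<Delta>D(1)]
    show "fps_assoc (?\<Delta>1 (\<Delta> x)) = ?\<Delta>2 (\<Delta> x)"
    proof (rule schroedinger_hom_eqI[of "\<lambda>x. fps_assoc (?\<Delta>1 (\<Delta> x))" "\<lambda>x. ?\<Delta>2 (\<Delta> x)"])
      show "fps_algebra_hom (\<lambda>x. fps_assoc (?\<Delta>1 (\<Delta> x)))"
        by (intro fps_algebra_hom_compose[OF fps_algebra_hom_assoc]
            fps_algebra_hom_compose[OF fps_algebra_hom_tensor_map] fps_algebra_hom_id \<Delta>)
      show "fps_algebra_hom (\<lambda>x. ?\<Delta>2 (\<Delta> x))"
        by (intro fps_algebra_hom_compose[OF fps_algebra_hom_tensor_map] fps_algebra_hom_id \<Delta>)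
      show "fps_assoc (?\<Delta>1 (\<Delta> (gen g))) = ?\<Delta>2 (\<Delta> (gen g))" for g
        by (simp add: \<Delta>_gen \<Delta>_grouplike \<Delta>D(2) fps_linear_add[OF map1(1)] fps_linear_add[OF map2(1)]
            map1(2) map2(2) fps_linear_add[OF fps_assoc(1)] fps_assoc(2) fps_pure_tensor_simps
            fps_one_tensor)
    qed
    note cl = counit_tensor_hom[OF \<epsilon>]
    have id_hom: "fps_algebra_hom (\<lambda>x :: schroedinger fps. x)"
      using fps_algebra_hom_id by (simp add: id_def)
    show "fps_tensor_lift (\<lambda>y z. fps_smult (\<epsilon> y) z) (\<Delta> x) = x"
    proof (rule schroedinger_hom_eqI[of "\<lambda>x. fps_tensor_lift (\<lambda>y z. fps_smult (\<epsilon> y) z) (\<Delta> x)" "\<lambda>x. x",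
          OF fps_algebra_hom_compose[OF cl(1) \<Delta>] id_hom])
      show "fps_tensor_lift (\<lambda>y z. fps_smult (\<epsilon> y) z) (\<Delta> (gen g)) = gen g" for g
        by (simp add: \<Delta>_gen fps_linear_add[OF fps_algebra_homD(1)[OF cl(1)]] cl(3) \<epsilon>_gen \<epsilon>D(2))
    qed
    show "fps_tensor_lift (\<lambda>y z. fps_smult (\<epsilon> z) y) (\<Delta> x) = x"
    proof (rule schroedinger_hom_eqI[of "\<lambda>x. fps_tensor_lift (\<lambda>y z. fps_smult (\<epsilon> z) y) (\<Delta> x)" "\<lambda>x. x",
          OF fps_algebra_hom_compose[OF cl(2) \<Delta>] id_hom])
      show "fps_tensor_lift (\<lambda>y z. fps_smult (\<epsilon> z) y) (\<Delta> (gen g)) = gen g" for g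
        by (simp add: \<Delta>_gen fps_linear_add[OF fps_algebra_homD(1)[OF cl(2)]] cl(4) \<epsilon>_gen
            \<epsilon>_grouplike)
    qed
    have bl: "fps_bilinear (\<lambda>y z. S y * z)" and br: "fps_bilinear (\<lambda>y z. y * S z)"
      by (rule fps_bilinear_compose[OF fps_bilinear_mult] S(1) fps_linear_ident(1))+
    let ?l = "fps_tensor_lift (\<lambda>y z. S y * z)" and ?r = "fps_tensor_lift (\<lambda>y z. y * S z)"
    note L = fps_tensor_lift[OF bl] and R = fps_tensor_lift[OF br]
    have M: "fps_linear (\<lambda>t. t * u)" "fps_linear (\<lambda>t. u * t)" for u :: "(schroedinger, schroedinger) tensor fps"
      using fps_bilinear_mult by (auto simp: fps_bilinear_def)
    have zero: "fps_linear (\<lambda>t :: (schroedinger, schroedinger) tensor fps. 0 :: schroedinger fps)"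
      by (rule fps_linearI) simp_all
    have left: "?l (\<Delta> (gen g) * t) = 0" for g t
    proof (rule fps_tensor_eqI[of "\<lambda>t. ?l (\<Delta> (gen g) * t)" "\<lambda>_. 0",
          OF fps_linear_compose[OF L(1) M(2)] zero])
      fix y z
      have "?l (\<Delta> (gen g) * (y \<otimes>\<^sub>h z))
          = S y * (gen g * z) + S y * S (gen g) * (grouplike (gen_weight g) * z)"
        by (simp add: \<Delta>_gen distrib_right fps_pure_tensor_mult fps_linear_add[OF L(1)] L(2) S(3))
      also have "\<dots> = S y * (gen g - gen g * (grouplike (- gen_weight g) * grouplike (gen_weight g))) * z"
        by (simp add: S_gen algebra_simps)
      finally show "?l (\<Delta> (gen g) * (y \<otimes>\<^sub>h z)) = 0" by (simp add: grouplike_inverse)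
    qed
    have right: "?r (t * \<Delta> (gen g)) = 0" for g t
    proof (rule fps_tensor_eqI[of "\<lambda>t. ?r (t * \<Delta> (gen g))" "\<lambda>_. 0",
          OF fps_linear_compose[OF R(1) M(1)] zero])
      fix y z
      have "?r ((y \<otimes>\<^sub>h z) * \<Delta> (gen g))
          = y * (S (gen g) * S z) + y * gen g * (S (grouplike (gen_weight g)) * S z)"
        by (simp add: \<Delta>_gen distrib_left fps_pure_tensor_mult fps_linear_add[OF R(1)] R(2) S(3))
      also have "\<dots> = y * (gen g * grouplike (- gen_weight g) - gen g * grouplike (- gen_weight g)) * S z"
        by (simp add: S_gen S_grouplike algebra_simps)
      finally show "?r ((y \<otimes>\<^sub>h z) * \<Delta> (gen g)) = 0" by simp
    qed
    have one: "?l (\<Delta> 1) = 1" "?r (\<Delta> 1) = 1"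
      by (simp_all add: \<Delta>D(2) fps_one_tensor L(2) R(2) S(2))
    have e: "fps_linear (\<lambda>x. fps_smult (\<epsilon> x) (1 :: schroedinger fps))"
      by (rule fps_bilinear_linear_left[OF fps_bilinear_smult \<epsilon>D(1)])
    show "?l (\<Delta> x) = fps_smult (\<epsilon> x) 1"
    proof (rule fps_linear_eqI[of "\<lambda>x. ?l (\<Delta> x)" "\<lambda>x. fps_smult (\<epsilon> x) 1",
          OF fps_linear_compose[OF L(1) \<Delta>D(1)] e])
      note l1 = fps_linear_const[OF fps_linear_compose[OF L(1) \<Delta>D(1)]] and l2 = fps_linear_const[OF e]
      fix a
      show "?l (\<Delta> (fps_const a)) = fps_smult (\<epsilon> (fps_const a)) 1"
      proof (induction a rule: schroedinger_induct)
        case 1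
        show ?case by (simp add: one \<epsilon>D(2))
      next
        case (2 g x)
        have "fps_const (schroedinger_of_gen g * x) = gen g * fps_const x" by (simp add: gen_def)
        then show ?case by (simp add: \<Delta>D(3) \<epsilon>D(3) \<epsilon>_gen left)
      qed (simp_all only: linear_add[OF l1] linear_add[OF l2] linear_scale[OF l1] linear_scale[OF l2])
    qed
    show "?r (\<Delta> x) = fps_smult (\<epsilon> x) 1"
    proof (rule fps_linear_eqI[of "\<lambda>x. ?r (\<Delta> x)" "\<lambda>x. fps_smult (\<epsilon> x) 1",
          OF fps_linear_compose[OF R(1) \<Delta>D(1)] e])
      note l1 = fps_linear_const[OF fps_linear_compose[OF R(1) \<Delta>D(1)]] and l2 = fps_linear_const[OF e]
      fix a
      show "?r (\<Delta> (fps_const a)) = fps_smult (\<epsilon> (fps_const a)) 1"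
      proof (induction a rule: schroedinger_induct_right)
        case 1
        show ?case by (simp add: one \<epsilon>D(2))
      next
        case (2 g x)
        have "fps_const (x * schroedinger_of_gen g) = fps_const x * gen g" by (simp add: gen_def)
        then show ?case by (simp add: \<Delta>D(3) \<epsilon>D(3) \<epsilon>_gen right)
      qed (simp_all only: linear_add[OF l1] linear_add[OF l2] linear_scale[OF l1] linear_scale[OF l2])
    qed
  qed
  moreover have two: "2 * c1 * gen Mg = 2 *\<^sub>R (c1 * gen Mg)"
    by (simp add: scaleR_2 mult_2 distrib_right)
  ultimately show ?thesis
    by (intro exI[of _ \<Delta>] exI[of _ \<epsilon>] exI[of _ S]) (simp add: \<Delta>_gen grouplike_def two)
qed

end

theory Submission
  imports Defs
begin

text \<open>
  As \<open>M\<close> is central, \<open>D \<otimes> M\<close> and \<open>M \<otimes> D\<close> commute, so \<open>R = exp (c\<^sub>1 D \<and> M)\<close>, and all the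
  legs of \<open>D \<and> M\<close> commute with each other; the identities that involve only \<open>R\<close> are thus additive
  identities between exponents. For a generator with \<open>[D, g] = - w g\<close>, moving \<open>g\<close> past
  \<open>R\<close> shifts the exponent by a multiple of \<open>w c\<^sub>1 M\<close> in one of the two factors, which is
  what turns \<open>\<Delta> g = 1 \<otimes> g + g \<otimes> exp (w c\<^sub>1 M)\<close> into its flip.
\<close>

section \<open>Exponentials and homomorphisms\<close>

text \<open>The relation passes to all powers by induction. As neither exponent has a constant term,
  coefficient \<open>n\<close> of each side involves only the terms with \<open>k \<le> n\<close>,
  so finite sums suffice.\<close>

lemma formal_exp_intertwine:
  fixes a a' b :: "'a::real_algebra_1 fps"
  assumes ab: "a * b = b * a'" and 0: "a $ 0 = 0" "a' $ 0 = 0"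
  shows "formal_exp a * b = b * formal_exp a'"
proof (rule fps_ext)
  fix n
  have "a ^ k * b = b * a' ^ k" for k
  proof (induction k)
    case (Suc k)
    have "a ^ Suc k * b = a * (a ^ k * b)" by (simp add: mult.assoc)
    also have "\<dots> = b * a' ^ Suc k" by (simp add: Suc ab flip: mult.assoc)
    finally show ?case .
  qed simp
  then have "(\<Sum>k\<le>n. (1 / fact k) *\<^sub>R a ^ k) * b = b * (\<Sum>k\<le>n. (1 / fact k) *\<^sub>R a' ^ k)"
    by (simp add: sum_distrib_left sum_distrib_right)
  moreover have "(formal_exp a * b) $ n = ((\<Sum>k\<le>n. (1 / fact k) *\<^sub>R a ^ k) * b) $ n"
    "(b * formal_exp a') $ n = (b * (\<Sum>k\<le>n. (1 / fact k) *\<^sub>R a' ^ k)) $ n"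
    by (intro mult_nth_cong; simp add: formal_exp_nth 0)+
  ultimately show "(formal_exp a * b) $ n = (b * formal_exp a') $ n" by simp
qed

lemma formal_exp_inverse:
  fixes a :: "'a::real_algebra_1 fps"
  assumes "a $ 0 = 0"
  shows "two_sided_inverse (formal_exp a) (formal_exp (- a))"
  using formal_exp_add[of a "- a"] formal_exp_add[of "- a" a] assms
  by (simp add: two_sided_inverse_def)

lemma ring_inverse_eqI: "two_sided_inverse x y \<Longrightarrow> ring_inverse x = y"
  unfolding ring_inverse_def two_sided_inverse_def
  by (rule the_equality) (simp, metis mult.assoc mult_1_left mult_1_right)

lemma formal_exp_nth_1: "a $ 0 = 0 \<Longrightarrow> formal_exp a $ 1 = a $ 1"
  for a :: "'a::real_algebra_1 fps"
  using formal_exp_nth[of a 1 1] by simp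

text \<open>Once \<open>fps_X * x\<close> is rewritten as \<open>fps_smult fps_X x\<close>, these
  rules move the parameter to the front of noncommutative products.\<close>

lemma fps_smult_mult:
  "fps_smult s x * y = fps_smult s (x * y)" "x * fps_smult s y = fps_smult s (x * y)"
  for x y :: "'a::real_algebra_1 fps"
  using fps_bilinear_mult[where 'a = 'a]
  by (auto simp: fps_bilinear_def intro: fps_linear_smult[of "(*) x"] fps_linear_smult[of "\<lambda>x. x * y"])

lemma fps_smult_scaleR: "fps_smult s (r *\<^sub>R x) = r *\<^sub>R fps_smult s x"
  by (simp flip: fps_smult_const add: mult.commute)

lemma fps_linear_X_mult: "fps_linear F \<Longrightarrow> F (fps_X * x) = fps_X * F x"
  for F :: "'a::real_algebra_1 fps \<Rightarrow> 'b::real_algebra_1 fps"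
  by (metis fps_linear_smult fps_smult_X)

lemma fps_algebra_hom_pure_tensor:
  "fps_algebra_hom (\<lambda>x :: 'a::real_algebra_1 fps. x \<otimes>\<^sub>h (1 :: 'b::real_algebra_1 fps))"
  "fps_algebra_hom (\<lambda>y :: 'b::real_algebra_1 fps. (1 :: 'a::real_algebra_1 fps) \<otimes>\<^sub>h y)"
  by (simp_all add: fps_algebra_hom_def fps_pure_tensor_linear fps_one_tensor fps_pure_tensor_mult)

text \<open>Multiplicativity comes from \<open>v * u = 1\<close> cancelling between two factors.
  This allows the intertwining property of \<open>R\<close> to be tested on generators
  alone.\<close>

lemma fps_algebra_hom_conjugate:
  assumes F: "fps_algebra_hom F" and u: "two_sided_inverse u v"
  shows "fps_algebra_hom (\<lambda>x. u * F x * v)"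
proof -
  have uv: "u * v = 1" and vu: "v * (u * x) = x" for x
    using u by (simp_all add: two_sided_inverse_def flip: mult.assoc)
  have "fps_linear (\<lambda>x. u * F x * v)"
    by (intro fps_bilinear_linear[OF fps_bilinear_mult] fps_algebra_homD(1)[OF F])
  then show ?thesis
    by (simp add: fps_algebra_hom_def fps_algebra_homD[OF F] uv vu mult.assoc)
qed

lemma fps_flip:
  "fps_linear fps_flip" "fps_flip (x \<otimes>\<^sub>h y) = y \<otimes>\<^sub>h x"
  using fps_tensor_lift[OF fps_bilinear_swap[OF fps_bilinear_pure_tensor]]
  by (simp_all add: fps_flip_def)

lemma fps_algebra_hom_flip:
  "fps_algebra_hom (fps_flip :: ('a::real_algebra_1, 'b::real_algebra_1) tensor fps \<Rightarrow> _)"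
  by (rule fps_algebra_hom_tensor) (simp_all add: fps_flip fps_pure_tensor_mult fps_one_tensor)

lemma leg12:
  "fps_linear (leg12 :: ('a::real_algebra_1, 'a) tensor fps \<Rightarrow> _)"
  "leg12 (x \<otimes>\<^sub>h y) = x \<otimes>\<^sub>h y \<otimes>\<^sub>h (1 :: 'a fps)"
proof -
  have "fps_bilinear (\<lambda>x y :: 'a fps. x \<otimes>\<^sub>h y \<otimes>\<^sub>h (1 :: 'a fps))"
    by (rule fps_bilinear_triple_fixed)
  note fps_tensor_lift[OF this]
  then show "fps_linear (leg12 :: ('a::real_algebra_1, 'a) tensor fps \<Rightarrow> _)"
    "leg12 (x \<otimes>\<^sub>h y) = x \<otimes>\<^sub>h y \<otimes>\<^sub>h (1 :: 'a fps)"
    by (simp_all add: leg12_def)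
qed

lemma leg13:
  "fps_linear (leg13 :: ('a::real_algebra_1, 'a) tensor fps \<Rightarrow> _)"
  "leg13 (x \<otimes>\<^sub>h y) = x \<otimes>\<^sub>h (1 :: 'a fps) \<otimes>\<^sub>h y"
proof -
  have "fps_bilinear (\<lambda>x y :: 'a fps. x \<otimes>\<^sub>h (1 :: 'a fps) \<otimes>\<^sub>h y)"
    unfolding fps_bilinear_def by (intro conjI allI fps_linear_intros)
  note fps_tensor_lift[OF this]
  then show "fps_linear (leg13 :: ('a::real_algebra_1, 'a) tensor fps \<Rightarrow> _)"
    "leg13 (x \<otimes>\<^sub>h y) = x \<otimes>\<^sub>h (1 :: 'a fps) \<otimes>\<^sub>h y"
    by (simp_all add: leg13_def)
qed

lemma leg23:
  "fps_linear (leg23 :: ('a::real_algebra_1, 'a) tensor fps \<Rightarrow> _)"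
  "leg23 (x \<otimes>\<^sub>h y) = (1 :: 'a fps) \<otimes>\<^sub>h x \<otimes>\<^sub>h y"
proof -
  have "fps_bilinear (\<lambda>x y :: 'a fps. (1 :: 'a fps) \<otimes>\<^sub>h x \<otimes>\<^sub>h y)"
    unfolding fps_bilinear_def by (intro conjI allI fps_linear_intros)
  note fps_tensor_lift[OF this]
  then show "fps_linear (leg23 :: ('a::real_algebra_1, 'a) tensor fps \<Rightarrow> _)"
    "leg23 (x \<otimes>\<^sub>h y) = (1 :: 'a fps) \<otimes>\<^sub>h x \<otimes>\<^sub>h y"
    by (simp_all add: leg23_def)
qed

lemma fps_algebra_hom_leg:
  "fps_algebra_hom (leg12 :: ('a::real_algebra_1, 'a) tensor fps \<Rightarrow> _)"
  "fps_algebra_hom (leg13 :: ('a::real_algebra_1, 'a) tensor fps \<Rightarrow> _)"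
  "fps_algebra_hom (leg23 :: ('a::real_algebra_1, 'a) tensor fps \<Rightarrow> _)"
  by (rule fps_algebra_hom_tensor;
      simp add: leg12 leg13 leg23 fps_pure_tensor_mult fps_one_tensor)+

section \<open>The exponential of a wedge of commuting elements\<close>

text \<open>The flip, the legs and both extensions of \<open>\<Delta>\<close> are algebra
  homomorphisms, so each sends the exponential to the exponential of the image of its exponent. It
  remains to compare commuting exponents.\<close>

lemma exp_wedge_abelian:
  fixes D M :: "'a::real_algebra_1 fps"
  assumes comm: "D * M = M * D"
  defines "R \<equiv> formal_exp (fps_X * (D \<and>\<^sub>h M))"
  shows exp_wedge_factor:
      "formal_exp (- (fps_X * (M \<otimes>\<^sub>h D))) * formal_exp (fps_X * (D \<otimes>\<^sub>h M)) = R"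
    and exp_wedge_inverse: "two_sided_inverse R (formal_exp (- (fps_X * (D \<and>\<^sub>h M))))"
    and exp_wedge_flip: "fps_flip R = formal_exp (- (fps_X * (D \<and>\<^sub>h M)))"
    and exp_wedge_Yang_Baxter: "leg12 R * leg13 R * leg23 R = leg23 R * leg13 R * leg12 R"
    and exp_wedge_classical: "classical_r_matrix R = fps_X * fps_const ((D \<and>\<^sub>h M) $ 0)"
    and exp_wedge_hexagon:
      "\<lbrakk>fps_algebra_hom \<Delta>; \<Delta> D = 1 \<otimes>\<^sub>h D + D \<otimes>\<^sub>h 1; \<Delta> M = 1 \<otimes>\<^sub>h M + M \<otimes>\<^sub>h 1\<rbrakk>
        \<Longrightarrow> fps_assoc (fps_tensor_map \<Delta> id R) = leg13 R * leg23 R"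
      "\<lbrakk>fps_algebra_hom \<Delta>; \<Delta> D = 1 \<otimes>\<^sub>h D + D \<otimes>\<^sub>h 1; \<Delta> M = 1 \<otimes>\<^sub>h M + M \<otimes>\<^sub>h 1\<rbrakk>
        \<Longrightarrow> fps_tensor_map id \<Delta> R = leg13 R * leg12 R"
proof -
  define A where "A = fps_X * (D \<and>\<^sub>h M)"
  have R: "R = formal_exp A" by (simp add: R_def A_def)
  have A0: "A $ 0 = 0" by (simp add: A_def)
  have A: "A = - (fps_X * (M \<otimes>\<^sub>h D)) + fps_X * (D \<otimes>\<^sub>h M)"
    by (simp add: A_def fps_wedge_def right_diff_distrib)
  show "formal_exp (- (fps_X * (M \<otimes>\<^sub>h D))) * formal_exp (fps_X * (D \<otimes>\<^sub>h M)) = R"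
    unfolding R A
    by (rule formal_exp_add[symmetric], unfold fps_smult_X[symmetric])
       (simp_all add: fps_smult_mult fps_pure_tensor_mult comm fps_smult_nth)
  show "two_sided_inverse R (formal_exp (- (fps_X * (D \<and>\<^sub>h M))))"
    unfolding R_def by (rule formal_exp_inverse) simp
  have "fps_flip A = - A"
    by (simp add: A_def fps_linear_X_mult[OF fps_flip(1)] fps_wedge_def
        fps_linear_diff[OF fps_flip(1)] fps_flip(2) right_diff_distrib)
  then show "fps_flip R = formal_exp (- (fps_X * (D \<and>\<^sub>h M)))"
    unfolding R fps_algebra_hom_formal_exp[OF fps_algebra_hom_flip A0] by (simp add: A_def)
  \<comment> \<open>In degree 1 the exponential agrees with \<open>A\<close>, and the factor
    \<open>fps_X\<close> in \<open>A\<close> lowers the index to 0.\<close>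
  show "classical_r_matrix R = fps_X * fps_const ((D \<and>\<^sub>h M) $ 0)"
    unfolding R classical_r_matrix_def formal_exp_nth_1[OF A0] by (simp add: A_def)
  note leg = fps_algebra_hom_formal_exp[OF fps_algebra_hom_leg(1) A0]
    fps_algebra_hom_formal_exp[OF fps_algebra_hom_leg(2) A0]
    fps_algebra_hom_formal_exp[OF fps_algebra_hom_leg(3) A0]
  have legA:
    "leg12 A = fps_X * (D \<otimes>\<^sub>h M \<otimes>\<^sub>h 1 - M \<otimes>\<^sub>h D \<otimes>\<^sub>h 1)"
    "leg13 A = fps_X * (D \<otimes>\<^sub>h 1 \<otimes>\<^sub>h M - M \<otimes>\<^sub>h 1 \<otimes>\<^sub>h D)"
    "leg23 A = fps_X * (1 \<otimes>\<^sub>h D \<otimes>\<^sub>h M - 1 \<otimes>\<^sub>h M \<otimes>\<^sub>h D)"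
    by (simp_all add: A_def fps_wedge_def fps_linear_X_mult[OF leg12(1)]
        fps_linear_X_mult[OF leg13(1)] fps_linear_X_mult[OF leg23(1)] leg12(2) leg13(2) leg23(2)
        fps_linear_diff[OF leg12(1)] fps_linear_diff[OF leg13(1)] fps_linear_diff[OF leg23(1)])
  have legA0: "leg12 A $ 0 = 0" "leg13 A $ 0 = 0" "leg23 A $ 0 = 0"
    by (simp_all add: legA)
  \<comment> \<open>Within each of the three tensor factors only 1, \<open>D\<close> and
    \<open>M\<close> are ever multiplied, and these commute.\<close>
  have commA: "leg13 A * leg12 A = leg12 A * leg13 A" "leg23 A * leg12 A = leg12 A * leg23 A"
    "leg23 A * leg13 A = leg13 A * leg23 A"
    unfolding legA fps_smult_X[symmetric] fps_smult_mult
    by (simp_all add: fps_pure_tensor_mult algebra_simps comm)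
  show "leg12 R * leg13 R * leg23 R = leg23 R * leg13 R * leg12 R"
    unfolding R leg
    by (simp add: legA0 commA distrib_left distrib_right add_ac flip: formal_exp_add)
  assume \<Delta>: "fps_algebra_hom \<Delta>" and prim: "\<Delta> D = 1 \<otimes>\<^sub>h D + D \<otimes>\<^sub>h 1" "\<Delta> M = 1 \<otimes>\<^sub>h M + M \<otimes>\<^sub>h 1"
  note \<Delta>_lin = fps_algebra_homD(1)[OF \<Delta>]
  let ?F = "\<lambda>t. fps_assoc (fps_tensor_map \<Delta> id t)" and ?G = "fps_tensor_map id \<Delta>"
  note map1 = fps_tensor_map[OF \<Delta>_lin fps_linear_ident(2)]
    and map2 = fps_tensor_map[OF fps_linear_ident(2) \<Delta>_lin]
  have F: "fps_algebra_hom ?F"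
    by (intro fps_algebra_hom_compose[OF fps_algebra_hom_assoc] fps_algebra_hom_tensor_map
        fps_algebra_hom_id \<Delta>)
  have G: "fps_algebra_hom ?G"
    by (intro fps_algebra_hom_tensor_map fps_algebra_hom_id \<Delta>)
  \<comment> \<open>In the coproduct of \<open>D\<close> or \<open>M\<close>, the summand with 1 on
    the right yields leg 13 and the one with 1 on the left yields leg 23.\<close>
  have "?F A = leg13 A + leg23 A"
    unfolding A_def fps_linear_X_mult[OF fps_algebra_homD(1)[OF F]]
    unfolding A_def[symmetric] legA
    by (simp add: fps_wedge_def fps_linear_diff[OF map1(1)] map1(2) prim fps_pure_tensor_simps
        fps_linear_diff[OF fps_assoc(1)] fps_linear_add[OF fps_assoc(1)] fps_assoc(2)
        distrib_left right_diff_distrib)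
  then show "?F R = leg13 R * leg23 R"
    unfolding R leg fps_algebra_hom_formal_exp[OF F A0]
    by (simp add: formal_exp_add legA0 commA)
  have "?G A = leg13 A + leg12 A"
    unfolding A_def fps_linear_X_mult[OF fps_algebra_homD(1)[OF G]]
    unfolding A_def[symmetric] legA
    by (simp add: fps_wedge_def fps_linear_diff[OF map2(1)] map2(2) prim fps_pure_tensor_simps
        distrib_left right_diff_distrib)
  then show "?G R = leg13 R * leg12 R"
    unfolding R leg fps_algebra_hom_formal_exp[OF G A0]
    by (simp add: formal_exp_add legA0 commA)
qed

section \<open>Intertwining the coproduct with its flip\<close>

text \<open>The weight in the group-like factor of the coproduct is minus the eigenvalue of
  \<open>gen g\<close> under the adjoint action of \<open>gen Dg\<close>; the intertwining rests on
  this match.\<close>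

lemma gen_Dg_mult_gen: "gen Dg * gen g = gen g * gen Dg - gen_weight g *\<^sub>R gen g"
proof -
  have "gen Dg * gen g = gen g * gen Dg + commutator (gen Dg) (gen g)"
    by (simp add: commutator_def)
  also have "commutator (gen Dg) (gen g) = - (gen_weight g *\<^sub>R gen g)"
  proof (cases g)
    case Dg
    then show ?thesis by (simp add: commutator_def)
  next
    case Mg
    then show ?thesis using schroedinger_commutation(11)[of Dg] by (simp add: commutator_def)
  qed (simp_all add: schroedinger_commutation scaleR_2 mult_2)
  finally show ?thesis by simp
qed

lemma gen_Mg_commute: "gen Mg * gen g = gen g * gen Mg"
  using schroedinger_commutation(11)[of g] by (simp add: commutator_def)

text \<open>Conjugation by \<open>R\<close> treats the two summands of the coproduct of
  \<open>gen g\<close> separately: the first gains a group-like factor, the second loses its own,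
  and together they form the flipped coproduct.\<close>

lemma exp_wedge_intertwines_gen:
  fixes g :: schroedinger_gen
  defines "R \<equiv> formal_exp (c1 * (gen Dg \<and>\<^sub>h gen Mg))"
  shows "R * (1 \<otimes>\<^sub>h gen g) = (grouplike (gen_weight g) \<otimes>\<^sub>h gen g) * R"
    and "R * (gen g \<otimes>\<^sub>h grouplike (gen_weight g)) = (gen g \<otimes>\<^sub>h 1) * R"
proof -
  define A where "A = c1 * (gen Dg \<and>\<^sub>h gen Mg)"
  define w where "w = gen_weight g"
  define z where "z = w *\<^sub>R (c1 * gen Mg)"
  have A0: "A $ 0 = 0" by (simp add: A_def)
  have z0: "(z \<otimes>\<^sub>h (1 :: schroedinger fps)) $ 0 = 0" "((1 :: schroedinger fps) \<otimes>\<^sub>h z) $ 0 = 0"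
    by (simp_all add: z_def fps_pure_tensor_def pure_tensor_simps)
  have exp_z: "formal_exp (z \<otimes>\<^sub>h 1) = grouplike w \<otimes>\<^sub>h (1 :: schroedinger fps)"
    "formal_exp (1 \<otimes>\<^sub>h z) = (1 :: schroedinger fps) \<otimes>\<^sub>h grouplike w"
    unfolding grouplike_def z_def[symmetric]
    by (rule fps_algebra_hom_formal_exp[symmetric]; simp add: fps_algebra_hom_pure_tensor z_def)+
  \<comment> \<open>Normal form: tensors expanded, scalars in front, \<open>gen g\<close> to the
    left of \<open>gen Dg\<close>, and \<open>gen Mg\<close> last.\<close>
  note norm = fps_wedge_def fps_pure_tensor_simps fps_pure_tensor_mult fps_smult_mult
    fps_smult_scaleR fps_module.scale_right_distrib fps_module.scale_right_diff_distrib
    scaleR_right_diff_distrib left_diff_distrib right_diff_distrib distrib_left distrib_right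
    gen_Dg_mult_gen[of g] gen_Mg_commute[of g] gen_Mg_commute[of Dg]
  \<comment> \<open>Centrality of \<open>gen Mg\<close> allows the exponential of the shifted
    exponent to be split.\<close>
  have Az: "A * (z \<otimes>\<^sub>h 1) = (z \<otimes>\<^sub>h 1) * A" "A * (1 \<otimes>\<^sub>h z) = (1 \<otimes>\<^sub>h z) * A"
    unfolding A_def z_def w_def fps_smult_X[symmetric] by (simp_all add: norm)
  have "A * (1 \<otimes>\<^sub>h gen g) = (1 \<otimes>\<^sub>h gen g) * (A + z \<otimes>\<^sub>h 1)"
    unfolding A_def z_def w_def fps_smult_X[symmetric] by (simp add: norm)
  \<comment> \<open>The shift is put before \<open>A\<close> so that, after splitting, its
    exponential stands next to \<open>1 \<otimes>\<^sub>h gen g\<close> and merges with it.\<close>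
  then have "R * (1 \<otimes>\<^sub>h gen g) = (1 \<otimes>\<^sub>h gen g) * formal_exp (z \<otimes>\<^sub>h 1 + A)"
    unfolding R_def A_def[symmetric] by (intro formal_exp_intertwine) (simp_all add: A0 z0 add.commute)
  also have "\<dots> = (grouplike w \<otimes>\<^sub>h gen g) * R"
    by (simp add: formal_exp_add Az A0 z0 exp_z R_def fps_pure_tensor_mult flip: A_def mult.assoc)
  finally show "R * (1 \<otimes>\<^sub>h gen g) = (grouplike (gen_weight g) \<otimes>\<^sub>h gen g) * R"
    by (simp only: w_def)
  have "A * (gen g \<otimes>\<^sub>h 1) = (gen g \<otimes>\<^sub>h 1) * (A - 1 \<otimes>\<^sub>h z)"
    unfolding A_def z_def w_def fps_smult_X[symmetric] by (simp add: norm)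
  \<comment> \<open>The shift lives in the other tensor factor and so commutes with
    \<open>gen g \<otimes>\<^sub>h 1\<close>. On the left it supplies the group-like factor already
    present in the second summand.\<close>
  then have "(A + 1 \<otimes>\<^sub>h z) * (gen g \<otimes>\<^sub>h 1) = (gen g \<otimes>\<^sub>h 1) * A"
    by (simp add: distrib_right right_diff_distrib fps_pure_tensor_mult)
  then have "formal_exp (A + 1 \<otimes>\<^sub>h z) * (gen g \<otimes>\<^sub>h 1) = (gen g \<otimes>\<^sub>h 1) * R"
    unfolding R_def A_def[symmetric] by (intro formal_exp_intertwine) (simp_all add: A0 z0)
  moreover have "formal_exp (A + 1 \<otimes>\<^sub>h z) = R * (1 \<otimes>\<^sub>h grouplike w)"
    by (simp add: formal_exp_add Az A0 z0 exp_z R_def flip: A_def)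
  ultimately show "R * (gen g \<otimes>\<^sub>h grouplike (gen_weight g)) = (gen g \<otimes>\<^sub>h 1) * R"
    by (simp add: mult.assoc fps_pure_tensor_mult w_def)
qed

theorem mainTheorem9:
  fixes \<Delta> :: "schroedinger fps \<Rightarrow> (schroedinger, schroedinger) tensor fps"
    and \<epsilon> :: "schroedinger fps \<Rightarrow> real fps"
    and S :: "schroedinger fps \<Rightarrow> schroedinger fps"
    and R :: "(schroedinger, schroedinger) tensor fps"
  assumes "topological_hopf_algebra \<Delta> \<epsilon> S"
    and "\<Delta> (gen Dg) = 1 \<otimes>\<^sub>h gen Dg + gen Dg \<otimes>\<^sub>h 1"
    and "\<Delta> (gen Mg) = 1 \<otimes>\<^sub>h gen Mg + gen Mg \<otimes>\<^sub>h 1"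
    and "\<Delta> (gen Pg) = 1 \<otimes>\<^sub>h gen Pg + gen Pg \<otimes>\<^sub>h formal_exp (c1 * gen Mg)"
    and "\<Delta> (gen Kg) = 1 \<otimes>\<^sub>h gen Kg + gen Kg \<otimes>\<^sub>h formal_exp (- (c1 * gen Mg))"
    and "\<Delta> (gen Hg) = 1 \<otimes>\<^sub>h gen Hg + gen Hg \<otimes>\<^sub>h formal_exp (2 * c1 * gen Mg)"
    and "\<Delta> (gen Cg) = 1 \<otimes>\<^sub>h gen Cg + gen Cg \<otimes>\<^sub>h formal_exp (- (2 * c1 * gen Mg))"
    and "R = formal_exp (- (c1 * (gen Mg \<otimes>\<^sub>h gen Dg))) * formal_exp (c1 * (gen Dg \<otimes>\<^sub>h gen Mg))"
  shows "triangular_R_matrix \<Delta> R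
    \<and> leg12 R * leg13 R * leg23 R = leg23 R * leg13 R * leg12 R
    \<and> (\<forall>X. R * \<Delta> X * ring_inverse R = fps_flip (\<Delta> X))
    \<and> classical_r_matrix R = c1 * (gen Dg \<and>\<^sub>h gen Mg)"
proof -
  note \<Delta>s = assms(2-7)
  have \<Delta>: "fps_algebra_hom \<Delta>" using assms(1) by (rule topological_hopf_algebra.comult_hom)
  have two: "2 * c1 * gen Mg = 2 *\<^sub>R (c1 * gen Mg)"
    by (simp add: scaleR_2 mult_2 distrib_right)
  \<comment> \<open>All six coproducts become one formula in the weight, with weight 0 for the
    primitive generators.\<close>
  have \<Delta>_gen: "\<Delta> (gen g) = 1 \<otimes>\<^sub>h gen g + gen g \<otimes>\<^sub>h grouplike (gen_weight g)" for g
    by (cases g) (simp_all add: \<Delta>s grouplike_def two)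
  note comm = gen_Mg_commute[of Dg, symmetric]
  note R = assms(8)[unfolded exp_wedge_factor[OF comm]]
  \<comment> \<open>The witness is the exponential of the negated exponent: the wedge is
    antisymmetric, so it is both the inverse and the flip of \<open>R\<close>.\<close>
  obtain R' where R': "two_sided_inverse R R'" and flip: "fps_flip R = R'"
    using exp_wedge_inverse[OF comm] exp_wedge_flip[OF comm] unfolding R by blast
  have inv: "ring_inverse R = R'" by (rule ring_inverse_eqI[OF R'])
  have intertwine: "R * \<Delta> X * R' = fps_flip (\<Delta> X)" for X
  proof (rule schroedinger_hom_eqI[of "\<lambda>X. R * \<Delta> X * R'" "\<lambda>X. fps_flip (\<Delta> X)",
        OF fps_algebra_hom_conjugate[OF \<Delta> R'] fps_algebra_hom_compose[OF fps_algebra_hom_flip \<Delta>]])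
    fix g
    have "R * \<Delta> (gen g) = fps_flip (\<Delta> (gen g)) * R"
      by (simp add: \<Delta>_gen distrib_left distrib_right R exp_wedge_intertwines_gen
          fps_linear_add[OF fps_flip(1)] fps_flip(2))
    then show "R * \<Delta> (gen g) * R' = fps_flip (\<Delta> (gen g))"
      using R' by (simp add: two_sided_inverse_def mult.assoc)
  qed
  have "universal_R_matrix \<Delta> R"
    unfolding universal_R_matrix_def inv
    using R' intertwine exp_wedge_hexagon[OF comm \<Delta> \<Delta>s(1,2)] unfolding R by blast
  \<comment> \<open>The generators are constant series, so the coefficient taken in the classical
    limit recovers the whole wedge.\<close>
  moreover have "gen Dg \<and>\<^sub>h gen Mg = fps_const ((gen Dg \<and>\<^sub>h gen Mg) $ 0)"
    by (simp add: gen_def fps_wedge_def fps_const_pure_tensor)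
  ultimately show ?thesis
    using exp_wedge_Yang_Baxter[OF comm, folded R] exp_wedge_classical[OF comm, folded R]
      intertwine flip
    unfolding triangular_R_matrix_def inv by simp
qed

end
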